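(* Let $\mathcal M$ be a finite von Neumann algebra acting on a Hilbert space $\mathcal H$, with a faithful, normal, tracial state $\tau$. Let $(e_n)_{n=1}^\infty$ be a sequence of idempotents in $\tilde{\mathcal M}$ with $e_ne_m=e_me_n=0$ when $n\neq m$. Then there is an idempotent in $\tilde{\mathcal M}$, denoted by $\sum_{n=1}^\infty e_n$, such that $\sum_{n=1}^Ne_n\to\sum_{n=1}^\infty e_n$ in measure as $N\to\infty$. Moreover, $\mathrm{supp}\big(\sum_{n=1}^Ne_n\big)\nearrow\mathrm{supp}\big(\sum_{n=1}^\infty e_n\big)$ as $N\to\infty$, whence $$\mathrm{supp}\Big(\sum_{n=1}^\infty e_n\Big)=\bigvee_{n=1}^\infty\mathrm{supp}(e_n)$$ and $$\mathrm{tr}\Big(\sum_{n=1}^\infty e_n\Big)=\sum_{n=1}^\infty\mathrm{tr}(e_n).$$ Also, $$\mathrm{range}\Big(\sum_{n=1}^\infty e_n\Big)=\bigvee_{n=1}^\infty\mathrm{range}(e_n).$$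
   Context: $\tilde{\mathcal M}$ is the $*$-algebra of closed, densely defined operators on $\mathcal H$ affiliated with $\mathcal M$ (i.e. commuting with every unitary in $\mathcal M'$), with sum $\overline{x+y}$ and product $\overline{x\cdot y}$ (closures); an idempotent in $\tilde{\mathcal M}$ is an element $e$ with $e\cdot e=e$ for this product. $\tilde{\mathcal M}$ is the completion of $\mathcal M$ in the measure topology, which is the translation invariant topology for which the sets $\{T:\exists\text{ projection }P\in\mathcal M,\ \|TP\|\le\varepsilon,\ \tau(P^\perp)\le\delta\}$, $\varepsilon,\delta>0$, form a fundamental system of neighborhoods of $0$; convergence "in measure" refers to this topology. $\mathrm{range}(x)$ is the range of $x$ as an operator on its domain in $\mathcal H$ (for idempotents it is a closed subspace), and $\mathrm{supp}(x)\in\mathcal M$ is the support projection, i.e. the projection onto $\ker(x)^\perp$. For an idempotent $e\in\tilde{\mathcal M}$, $\mathrm{tr}(e)=\tau(\mathrm{supp}(e))$. For subspaces, $\bigvee$ denotes the closed linear span; for projections, the supremum. *)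

theory Defs
  imports "HOL-Analysis.Analysis"
begin

section \<open>Complex Hilbert spaces\<close>

text \<open>The inner product is linear in the first and conjugate linear in the second argument.
  Topology, norm and completeness come from the library class \<open>banach\<close>; no separability or
  dimension assumption is made.\<close>

class complex_hilbert = banach +
  fixes scaleC :: "complex \<Rightarrow> 'a \<Rightarrow> 'a" (infixr "*\<^sub>C" 75)
    and cinner :: "'a \<Rightarrow> 'a \<Rightarrow> complex"
  assumes scaleC_add_right: "c *\<^sub>C (x + y) = c *\<^sub>C x + c *\<^sub>C y"
    and scaleC_add_left: "(c + d) *\<^sub>C x = c *\<^sub>C x + d *\<^sub>C x"
    and scaleC_scaleC: "c *\<^sub>C (d *\<^sub>C x) = (c * d) *\<^sub>C x"
    and scaleC_of_real: "complex_of_real r *\<^sub>C x = scaleR r x"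
    and cinner_add_left: "cinner (x + y) z = cinner x z + cinner y z"
    and cinner_scaleC_left: "cinner (c *\<^sub>C x) y = c * cinner x y"
    and cinner_commute: "cinner x y = cnj (cinner y x)"
    and cinner_self: "cinner x x = complex_of_real ((norm x)\<^sup>2)"

global_interpretation complex_vector:
  vector_space "scaleC :: complex \<Rightarrow> 'a \<Rightarrow> 'a::complex_hilbert"
proof
  show "1 *\<^sub>C x = x" for x :: 'a
    using scaleC_of_real[of 1 x] by simp
qed (simp_all add: scaleC_add_right scaleC_add_left scaleC_scaleC)

definition closed_cspan :: "'a::complex_hilbert set \<Rightarrow> 'a set" where
  "closed_cspan S = closure (complex_vector.span S)"

definition orth_compl :: "'a::complex_hilbert set \<Rightarrow> 'a set" where
  "orth_compl S = {x. \<forall>y\<in>S. cinner x y = 0}"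


section \<open>Bounded operators and von Neumann algebras\<close>

definition bounded_op :: "('a::complex_hilbert \<Rightarrow> 'a) \<Rightarrow> bool" where
  "bounded_op A \<longleftrightarrow> bounded_linear A \<and> (\<forall>c x. A (c *\<^sub>C x) = c *\<^sub>C A x)"

definition is_adjoint :: "('a::complex_hilbert \<Rightarrow> 'a) \<Rightarrow> ('a \<Rightarrow> 'a) \<Rightarrow> bool" where
  "is_adjoint A B \<longleftrightarrow> (\<forall>x y. cinner (A x) y = cinner x (B y))"

definition is_projection :: "('a::complex_hilbert \<Rightarrow> 'a) \<Rightarrow> bool" where
  "is_projection P \<longleftrightarrow> bounded_op P \<and> P \<circ> P = P \<and> is_adjoint P P"

definition is_unitary :: "('a::complex_hilbert \<Rightarrow> 'a) \<Rightarrow> bool" where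
  "is_unitary U \<longleftrightarrow> bounded_op U \<and> (\<exists>V. is_adjoint U V \<and> V \<circ> U = id \<and> U \<circ> V = id)"

definition positive_op :: "('a::complex_hilbert \<Rightarrow> 'a) \<Rightarrow> bool" where
  "positive_op A \<longleftrightarrow> bounded_op A \<and> (\<forall>x. cinner (A x) x \<in> \<real>\<^sub>\<ge>\<^sub>0)"

definition op_le :: "('a::complex_hilbert \<Rightarrow> 'a) \<Rightarrow> ('a \<Rightarrow> 'a) \<Rightarrow> bool" where
  "op_le A B \<longleftrightarrow> positive_op (\<lambda>x. B x - A x)"

definition is_projection_Sup :: "('a::complex_hilbert \<Rightarrow> 'a) set \<Rightarrow> ('a \<Rightarrow> 'a) \<Rightarrow> bool" where
  "is_projection_Sup F P \<longleftrightarrow> is_projection P \<and> (\<forall>Q\<in>F. op_le Q P) \<and>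
     (\<forall>R. is_projection R \<and> (\<forall>Q\<in>F. op_le Q R) \<longrightarrow> op_le P R)"

text \<open>\<open>X N \<nearrow> A\<close>: increasing in the operator order, with strong limit (equivalently, supremum)
  \<open>A\<close>.\<close>

definition increases_to :: "(nat \<Rightarrow> 'a::complex_hilbert \<Rightarrow> 'a) \<Rightarrow> ('a \<Rightarrow> 'a) \<Rightarrow> bool" where
  "increases_to X A \<longleftrightarrow> (\<forall>N. op_le (X N) (X (Suc N))) \<and> (\<forall>x. (\<lambda>N. X N x) \<longlonglongrightarrow> A x)"

definition commutant :: "('a::complex_hilbert \<Rightarrow> 'a) set \<Rightarrow> ('a \<Rightarrow> 'a) set" where
  "commutant S = {A. bounded_op A \<and> (\<forall>B\<in>S. A \<circ> B = B \<circ> A)}"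

text \<open>The bicommutant condition makes \<open>M\<close> a unital subalgebra of the bounded operators.\<close>

definition von_neumann_algebra :: "('a::complex_hilbert \<Rightarrow> 'a) set \<Rightarrow> bool" where
  "von_neumann_algebra M \<longleftrightarrow> (\<forall>A\<in>M. bounded_op A) \<and> (\<forall>A\<in>M. \<exists>B\<in>M. is_adjoint A B) \<and>
     commutant (commutant M) = M"

text \<open>Finiteness: every isometry in \<open>M\<close> is unitary.\<close>

definition finite_von_neumann_algebra :: "('a::complex_hilbert \<Rightarrow> 'a) set \<Rightarrow> bool" where
  "finite_von_neumann_algebra M \<longleftrightarrow> von_neumann_algebra M \<and>
     (\<forall>V\<in>M. \<forall>W\<in>M. is_adjoint V W \<and> W \<circ> V = id \<longrightarrow> V \<circ> W = id)"

definition state_on ::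
    "('a::complex_hilbert \<Rightarrow> 'a) set \<Rightarrow> (('a \<Rightarrow> 'a) \<Rightarrow> complex) \<Rightarrow> bool" where
  "state_on M \<tau> \<longleftrightarrow>
     (\<forall>A\<in>M. \<forall>B\<in>M. \<tau> (\<lambda>x. A x + B x) = \<tau> A + \<tau> B) \<and>
     (\<forall>c. \<forall>A\<in>M. \<tau> (\<lambda>x. c *\<^sub>C A x) = c * \<tau> A) \<and>
     (\<forall>A\<in>M. positive_op A \<longrightarrow> \<tau> A \<in> \<real>\<^sub>\<ge>\<^sub>0) \<and>
     \<tau> id = 1"

definition tracial_on ::
    "('a::complex_hilbert \<Rightarrow> 'a) set \<Rightarrow> (('a \<Rightarrow> 'a) \<Rightarrow> complex) \<Rightarrow> bool" where
  "tracial_on M \<tau> \<longleftrightarrow> (\<forall>A\<in>M. \<forall>B\<in>M. \<tau> (A \<circ> B) = \<tau> (B \<circ> A))"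

definition faithful_on ::
    "('a::complex_hilbert \<Rightarrow> 'a) set \<Rightarrow> (('a \<Rightarrow> 'a) \<Rightarrow> complex) \<Rightarrow> bool" where
  "faithful_on M \<tau> \<longleftrightarrow> (\<forall>A\<in>M. positive_op A \<and> \<tau> A = 0 \<longrightarrow> A = (\<lambda>_. 0))"

text \<open>Normality: \<open>\<tau>\<close> preserves suprema (taken in \<open>M\<close>) of upward directed sets of positive elements
  (arbitrary nets, not only sequences). For a state the values on positive elements are real, so
  the real part carries no loss.\<close>

definition normal_on ::
    "('a::complex_hilbert \<Rightarrow> 'a) set \<Rightarrow> (('a \<Rightarrow> 'a) \<Rightarrow> complex) \<Rightarrow> bool" where
  "normal_on M \<tau> \<longleftrightarrow> (\<forall>D S.
     D \<subseteq> M \<and> D \<noteq> {} \<and> (\<forall>A\<in>D. positive_op A) \<and>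
     (\<forall>A\<in>D. \<forall>B\<in>D. \<exists>C\<in>D. op_le A C \<and> op_le B C) \<and>
     S \<in> M \<and> (\<forall>A\<in>D. op_le A S) \<and> (\<forall>T\<in>M. (\<forall>A\<in>D. op_le A T) \<longrightarrow> op_le S T)
     \<longrightarrow> Re (\<tau> S) = (SUP A\<in>D. Re (\<tau> A)))"


section \<open>Unbounded operators\<close>

text \<open>A (partially defined) operator on the Hilbert space is identified with its graph, so that its
  domain, its range and the closure of an operator are \<open>Domain\<close>, \<open>Range\<close> and \<open>closure\<close>.\<close>

type_synonym 'a unbounded_op = "('a \<times> 'a) set"

definition graph_of :: "('a \<Rightarrow> 'a) \<Rightarrow> 'a unbounded_op" where
  "graph_of A = {(x, A x) | x. True}"

definition linear_operator :: "'a::complex_hilbert unbounded_op \<Rightarrow> bool" where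
  "linear_operator T \<longleftrightarrow> single_valued T \<and> (0, 0) \<in> T \<and>
     (\<forall>x y x' y'. (x, y) \<in> T \<and> (x', y') \<in> T \<longrightarrow> (x + x', y + y') \<in> T) \<and>
     (\<forall>c x y. (x, y) \<in> T \<longrightarrow> (c *\<^sub>C x, c *\<^sub>C y) \<in> T)"

definition op_plus ::
    "'a::complex_hilbert unbounded_op \<Rightarrow> 'a unbounded_op \<Rightarrow> 'a unbounded_op" where
  "op_plus S T = {(x, y + z) | x y z. (x, y) \<in> S \<and> (x, z) \<in> T}"

definition op_uminus :: "'a::complex_hilbert unbounded_op \<Rightarrow> 'a unbounded_op" where
  "op_uminus T = {(x, - y) | x y. (x, y) \<in> T}"

definition op_times :: "'a unbounded_op \<Rightarrow> 'a unbounded_op \<Rightarrow> 'a unbounded_op" where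
  "op_times S T = {(x, z) | x y z. (x, y) \<in> T \<and> (y, z) \<in> S}"

definition op_kernel :: "'a::complex_hilbert unbounded_op \<Rightarrow> 'a set" where
  "op_kernel T = {x. (x, 0) \<in> T}"

definition op_norm_le :: "'a::complex_hilbert unbounded_op \<Rightarrow> real \<Rightarrow> bool" where
  "op_norm_le T c \<longleftrightarrow> Domain T = UNIV \<and> (\<forall>x y. (x, y) \<in> T \<longrightarrow> norm y \<le> c * norm x)"

definition supp :: "'a::complex_hilbert unbounded_op \<Rightarrow> 'a \<Rightarrow> 'a" where
  "supp T = (THE P. is_projection P \<and> range P = orth_compl (op_kernel T))"


section \<open>The algebra of affiliated operators\<close>

definition affiliated_ops ::
    "('a::complex_hilbert \<Rightarrow> 'a) set \<Rightarrow> 'a unbounded_op set" where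
  "affiliated_ops M = {T. linear_operator T \<and> closed T \<and> closure (Domain T) = UNIV \<and>
     (\<forall>U\<in>commutant M. is_unitary U \<longrightarrow>
        op_times (graph_of U) T = op_times T (graph_of U))}"

definition aff_zero :: "'a::complex_hilbert unbounded_op" where
  "aff_zero = graph_of (\<lambda>_. 0)"

definition aff_plus ::
    "'a::complex_hilbert unbounded_op \<Rightarrow> 'a unbounded_op \<Rightarrow> 'a unbounded_op" where
  "aff_plus S T = closure (op_plus S T)"

definition aff_minus ::
    "'a::complex_hilbert unbounded_op \<Rightarrow> 'a unbounded_op \<Rightarrow> 'a unbounded_op" where
  "aff_minus S T = aff_plus S (op_uminus T)"

definition aff_times ::
    "'a::complex_hilbert unbounded_op \<Rightarrow> 'a unbounded_op \<Rightarrow> 'a unbounded_op" where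
  "aff_times S T = closure (op_times S T)"

text \<open>\<open>aff_sum e N\<close> is the sum of the first \<open>N\<close> terms \<open>e 0, \<dots>, e (N - 1)\<close>.\<close>

primrec aff_sum ::
    "(nat \<Rightarrow> 'a::complex_hilbert unbounded_op) \<Rightarrow> nat \<Rightarrow> 'a unbounded_op" where
  "aff_sum e 0 = aff_zero"
| "aff_sum e (Suc N) = aff_plus (aff_sum e N) (e N)"

definition aff_idempotent ::
    "('a::complex_hilbert \<Rightarrow> 'a) set \<Rightarrow> 'a unbounded_op \<Rightarrow> bool" where
  "aff_idempotent M e \<longleftrightarrow> e \<in> affiliated_ops M \<and> aff_times e e = e"

definition tr ::
    "(('a::complex_hilbert \<Rightarrow> 'a) \<Rightarrow> complex) \<Rightarrow> 'a unbounded_op \<Rightarrow> complex" where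
  "tr \<tau> e = \<tau> (supp e)"

definition measure_nhd ::
    "('a::complex_hilbert \<Rightarrow> 'a) set \<Rightarrow> (('a \<Rightarrow> 'a) \<Rightarrow> complex) \<Rightarrow> real \<Rightarrow> real
      \<Rightarrow> 'a unbounded_op set" where
  "measure_nhd M \<tau> \<epsilon> \<delta> = {T \<in> affiliated_ops M. \<exists>P\<in>M. is_projection P \<and>
     op_norm_le (aff_times T (graph_of P)) \<epsilon> \<and> Re (\<tau> (\<lambda>x. x - P x)) \<le> \<delta>}"

text \<open>Convergence in the translation invariant topology on \<open>affiliated_ops M\<close> in which the sets
  \<open>measure_nhd M \<tau> \<epsilon> \<delta>\<close> form a fundamental system of neighbourhoods of zero.\<close>

definition converges_in_measure ::
    "('a::complex_hilbert \<Rightarrow> 'a) set \<Rightarrow> (('a \<Rightarrow> 'a) \<Rightarrow> complex) \<Rightarrow> (nat \<Rightarrow> 'a unbounded_op)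
      \<Rightarrow> 'a unbounded_op \<Rightarrow> bool" where
  "converges_in_measure M \<tau> X T \<longleftrightarrow> T \<in> affiliated_ops M \<and> (\<forall>N. X N \<in> affiliated_ops M) \<and>
     (\<forall>\<epsilon>>0. \<forall>\<delta>>0. \<forall>\<^sub>F N in sequentially. aff_minus (X N) T \<in> measure_nhd M \<tau> \<epsilon> \<delta>)"

end

theory Submission
  imports Defs
begin

text \<open>An affiliated idempotent is an oblique projection: it is determined by its range \<open>R\<close> and its
  kernel \<open>K\<close>, closed subspaces with \<open>R \<inter> K = 0\<close> and \<open>R + K\<close> dense whose orthogonal projections lie
  in \<open>M\<close>. Products, sums and limits of orthogonal idempotents thereby turn into statements about the
  lattice of projections of \<open>M\<close>, where everything follows from the modular law
  \<open>\<tau>(p \<or> q) + \<tau>(p \<and> q) = \<tau>(p) + \<tau>(q)\<close>, faithfulness and normality. The modular law is obtained without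
  polar decomposition: for a contraction \<open>T\<close> in \<open>M\<close> the traces of \<open>(1 - T\<^sup>*T)\<^sup>n\<close> and \<open>(1 - TT\<^sup>*)\<^sup>n\<close> agree,
  and the powers with even exponent decrease strongly to the projections onto the kernels of \<open>T\<close> and \<open>T\<^sup>*\<close>. The
  sum of the series is the oblique projection onto the closed span of the ranges along the intersection
  of the kernels.\<close>

text \<open>Since \<open>R + K\<close> is dense but in general not closed, an affiliated idempotent
  may be unbounded, and sums, differences and products carry a closure. The proof computes these
  closures directly on graphs of oblique projections. What it then needs are equalities between
  closed spans and intersections, and in the lattice of all closed subspaces these fail: that
  lattice is not even modular. The substitute is counting as in finite dimension: one inclusion is
  checked by hand, and the other follows because nested subspaces of equal trace coincide. The
  delicate point is the limit. The ranges up to \<open>N\<close> meet the intersection of all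
  kernels trivially for every \<open>N\<close>, but this does not pass formally to the closed span
  of all ranges. What passes is the dimension count, by normality; it shows that range and kernel of
  the sum span the space, and the trivial intersection is recovered from the count. Even powers are
  used because their quadratic form at \<open>x\<close> is the square of the norm of
  \<open>(C ^^ n) x\<close>, so neither square roots nor spectral theory enter. For convergence, the
  remainder is again a sum of the same kind, for the shifted sequence, so no norm has to be
  estimated.\<close>

section \<open>Geometry of complex Hilbert spaces\<close>

lemma norm_scaleC: "norm (c *\<^sub>C x) = cmod c * norm (x::'a::complex_hilbert)"
proof -
  have "complex_of_real ((norm (c *\<^sub>C x))\<^sup>2) = c * cnj (c * cinner x x)"
    by (metis cinner_commute cinner_scaleC_left cinner_self)
  also have "\<dots> = complex_of_real ((cmod c * norm x)\<^sup>2)"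
    using complex_norm_square[of c] by (simp add: cinner_self power_mult_distrib)
  finally have "(norm (c *\<^sub>C x))\<^sup>2 = (cmod c * norm x)\<^sup>2"
    by (simp only: of_real_eq_iff)
  then show ?thesis by (simp add: power2_eq_iff_nonneg)
qed

lemma norm_add_square:
  "(norm (x + y))\<^sup>2 = (norm x)\<^sup>2 + (norm y)\<^sup>2 + 2 * Re (cinner x (y::'a::complex_hilbert))"
proof -
  have "cinner (x + y) (x + y) = cinner x x + cinner y y + (cinner x y + cnj (cinner x y))"
    using cinner_commute[of "x + y" x] cinner_commute[of "x + y" y]
    by (metis (no_types, lifting) ab_semigroup_add_class.add_ac(1) add.commute cinner_add_left
        cinner_commute complex_cnj_add)
  then have "Re (cinner (x + y) (x + y)) = Re (cinner x x + cinner y y + (cinner x y + cnj (cinner x y)))"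
    by simp
  then show ?thesis by (simp add: cinner_self)
qed

text \<open>Cauchy-Schwarz comes from the triangle inequality, which the class provides: squaring it
  bounds the real part, and multiplying \<open>x\<close> by the conjugate of
  \<open>cinner x y\<close> makes the real part equal to the squared modulus.\<close>

lemma norm_cinner_le: "cmod (cinner x y) \<le> norm x * norm (y::'a::complex_hilbert)"
proof -
  have real: "Re (cinner u y) \<le> norm u * norm y" for u
  proof -
    have "(norm (u + y))\<^sup>2 \<le> (norm u + norm y)\<^sup>2"
      by (simp add: norm_triangle_ineq power_mono)
    then show ?thesis by (simp add: norm_add_square power2_sum)
  qed
  let ?c = "cinner x y"
  have "(cmod ?c)\<^sup>2 = Re (cinner (cnj ?c *\<^sub>C x) y)"
    by (simp only: cinner_scaleC_left) (simp add: cmod_power2, simp add: power2_eq_square)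
  also have "\<dots> \<le> cmod ?c * (norm x * norm y)"
    using real[of "cnj ?c *\<^sub>C x"] by (simp add: norm_scaleC)
  finally show ?thesis
    by (cases "?c = 0") (simp_all add: power2_eq_square)
qed

lemma cinner_add_right: "cinner x (y + z) = cinner x y + cinner (x::'a::complex_hilbert) z"
  by (metis cinner_add_left cinner_commute complex_cnj_add)

lemma cinner_scaleC_right: "cinner x (c *\<^sub>C y) = cnj c * cinner (x::'a::complex_hilbert) y"
  by (metis cinner_commute cinner_scaleC_left complex_cnj_mult)

interpretation cinner: bounded_bilinear "cinner :: 'a::complex_hilbert \<Rightarrow> 'a \<Rightarrow> complex"
proof
  show "\<exists>K. \<forall>a b. norm (cinner a b) \<le> norm (a::'a) * norm b * K"
    using norm_cinner_le by (metis mult.right_neutral)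
qed (simp_all add: cinner_add_left cinner_add_right cinner_scaleC_left cinner_scaleC_right
      scaleR_conv_of_real flip: scaleC_of_real)

interpretation scaleC: bounded_bilinear "scaleC :: complex \<Rightarrow> 'a \<Rightarrow> 'a::complex_hilbert"
proof
  show "\<exists>K. \<forall>a b. norm (a *\<^sub>C b) \<le> norm a * norm (b::'a) * K"
    by (metis norm_scaleC mult.right_neutral order_refl)
qed (simp_all add: scaleC_add_left scaleC_add_right scaleC_scaleC scaleR_conv_of_real mult.commute
      flip: scaleC_of_real)

lemma cinner_eq_zero_self [simp]: "cinner x x = 0 \<longleftrightarrow> x = (0::'a::complex_hilbert)"
  by (simp add: cinner_self)

lemma cinner_eq_zero_commute: "cinner x y = 0 \<longleftrightarrow> cinner y (x::'a::complex_hilbert) = 0"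
  by (metis cinner_commute complex_cnj_zero)

lemma cinner_ext: "(\<And>z. cinner x z = cinner y z) \<Longrightarrow> x = (y::'a::complex_hilbert)"
  using cinner_eq_zero_self[of "x - y"] by (metis cinner.diff_left right_minus_eq)

lemma norm_diff_square:
  "(norm (x - y))\<^sup>2 = (norm x)\<^sup>2 + (norm y)\<^sup>2 - 2 * Re (cinner x (y::'a::complex_hilbert))"
  using norm_add_square[of x "- y"] by (simp add: cinner.minus_right)

section \<open>Closed subspaces and orthogonal decomposition\<close>

definition closed_csubspace :: "'a::complex_hilbert set \<Rightarrow> bool" where
  "closed_csubspace S \<longleftrightarrow> closed S \<and> complex_vector.subspace S"

lemma closed_csubspaceD:
  assumes "closed_csubspace S"
  shows "closed S" "0 \<in> S" "x \<in> S \<Longrightarrow> y \<in> S \<Longrightarrow> x + y \<in> S" "x \<in> S \<Longrightarrow> c *\<^sub>C x \<in> S"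
    "x \<in> S \<Longrightarrow> y \<in> S \<Longrightarrow> x - y \<in> S" "x \<in> S \<Longrightarrow> - x \<in> S"
  using assms unfolding closed_csubspace_def
  by (auto intro: complex_vector.subspace_0 complex_vector.subspace_add
      complex_vector.subspace_scale complex_vector.subspace_diff complex_vector.subspace_neg)

lemma closed_csubspace_UNIV [simp]: "closed_csubspace UNIV"
  and closed_csubspace_zero [simp]: "closed_csubspace {0}"
  by (simp_all add: closed_csubspace_def complex_vector.subspace_0 complex_vector.subspace_single_0)

lemma closed_csubspace_INT: "(\<And>i. i \<in> I \<Longrightarrow> closed_csubspace (S i)) \<Longrightarrow> closed_csubspace (\<Inter>i\<in>I. S i)"
  unfolding closed_csubspace_def by (auto intro: complex_vector.subspace_Inter)

lemma closed_csubspace_Int: "closed_csubspace S \<Longrightarrow> closed_csubspace T \<Longrightarrow> closed_csubspace (S \<inter> T)"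
  unfolding closed_csubspace_def by (auto intro: complex_vector.subspace_inter)

lemma Int_eq_zero_subset:
  assumes "closed_csubspace S" "closed_csubspace T" "S \<inter> T \<subseteq> {0}"
  shows "S \<inter> T = {0}"
  using assms closed_csubspaceD(2) by blast

lemma closed_csubspace_orth_compl [simp]: "closed_csubspace (orth_compl S)"
proof -
  have "orth_compl S = (\<Inter>y\<in>S. {x. cinner x y = 0})" by (auto simp: orth_compl_def)
  moreover have "closed {x. cinner x y = 0}" for y :: 'a
    by (intro closed_Collect_eq continuous_intros bounded_linear.continuous_on[OF cinner.bounded_linear_left])
  ultimately show ?thesis
    by (auto simp: closed_csubspace_def complex_vector.subspace_def orth_compl_def
        cinner_add_left cinner_scaleC_left cinner.zero_left)
qed

lemma orth_compl_antimono: "S \<subseteq> T \<Longrightarrow> orth_compl T \<subseteq> orth_compl S"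
  by (auto simp: orth_compl_def)

lemma subset_orth_compl_orth_compl: "S \<subseteq> orth_compl (orth_compl S)"
  by (auto simp: orth_compl_def cinner_eq_zero_commute)

lemma orth_compl_Int_self: "x \<in> S \<Longrightarrow> x \<in> orth_compl S \<Longrightarrow> x = 0"
  by (auto simp: orth_compl_def)

lemma orthogonal_decomposition:
  assumes S: "closed_csubspace (S :: 'a::complex_hilbert set)"
  shows "\<exists>p\<in>S. x - p \<in> orth_compl S"
proof -
  define d where "d = infdist x S"
  have ne: "S \<noteq> {}" using closed_csubspaceD(2)[OF S] by auto
  have d_le: "d \<le> norm (x - s)" if "s \<in> S" for s
    using infdist_le[OF that, of x] by (simp add: d_def dist_norm)
  have d0: "0 \<le> d" by (simp add: d_def infdist_nonneg)
  have "\<exists>s\<in>S. (norm (x - s))\<^sup>2 < d\<^sup>2 + inverse (real (Suc n))" for n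
  proof -
    have "d < sqrt (d\<^sup>2 + inverse (real (Suc n)))"
      by (rule real_less_rsqrt) simp
    moreover have "bdd_below (dist x ` S)" by (rule bdd_belowI[of _ 0]) auto
    ultimately obtain s where "s \<in> S" "dist x s < sqrt (d\<^sup>2 + inverse (real (Suc n)))"
      unfolding d_def infdist_def using ne by (auto simp: cInf_less_iff)
    moreover have "(sqrt (d\<^sup>2 + inverse (real (Suc n))))\<^sup>2 = d\<^sup>2 + inverse (real (Suc n))"
      by (simp add: add_nonneg_nonneg)
    ultimately show ?thesis
      by (metis dist_norm norm_ge_zero pos2 power_strict_mono)
  qed
  then obtain p where pS: "\<And>n. p n \<in> S"
    and p: "\<And>n. (norm (x - p n))\<^sup>2 < d\<^sup>2 + inverse (real (Suc n))" by metis
  have bound: "(norm (p m - p n))\<^sup>2 \<le> 2 * inverse (real (Suc m)) + 2 * inverse (real (Suc n))" for m n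
  proof -
    \<comment> \<open>The midpoint of two near-minimisers stays in \<open>S\<close>, hence at
      distance at least \<open>d\<close> from \<open>x\<close>; the parallelogram law turns this
      into smallness of their difference.\<close>
    let ?u = "x - p m" and ?v = "x - p n" and ?w = "(1/2) *\<^sub>R (p m + p n)"
    have "?w \<in> S"
      using closed_csubspaceD(3,4)[OF S] pS by (metis scaleC_of_real)
    then have "d\<^sup>2 \<le> (norm (x - ?w))\<^sup>2" using d_le d0 by (simp add: power_mono)
    moreover have "?u + ?v = 2 *\<^sub>R (x - ?w)" by (simp add: algebra_simps scaleR_2)
    then have "(norm (?u + ?v))\<^sup>2 = 4 * (norm (x - ?w))\<^sup>2" by (simp add: power_mult_distrib)
    moreover have "(norm (?u + ?v))\<^sup>2 + (norm (?v - ?u))\<^sup>2 = 2 * (norm ?u)\<^sup>2 + 2 * (norm ?v)\<^sup>2"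
      using norm_add_square[of ?v ?u] norm_diff_square[of ?v ?u] by (simp add: add.commute)
    moreover have "?v - ?u = p m - p n" by simp
    ultimately show ?thesis using p[of m] p[of n] by simp
  qed
  have "Cauchy p"
  proof (rule metric_CauchyI)
    fix e :: real assume e: "0 < e"
    then obtain N where N: "inverse (real (Suc N)) < e\<^sup>2 / 4"
      using reals_Archimedean[of "e\<^sup>2 / 4"] by auto
    have "dist (p m) (p n) < e" if "m \<ge> N" "n \<ge> N" for m n
    proof -
      have "inverse (real (Suc m)) \<le> inverse (real (Suc N))" "inverse (real (Suc n)) \<le> inverse (real (Suc N))"
        using that by auto
      then have "(norm (p m - p n))\<^sup>2 < e\<^sup>2" using bound[of m n] N by linarith
      then show ?thesis using e by (simp add: dist_norm power_less_imp_less_base)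
    qed
    then show "\<exists>N. \<forall>m\<ge>N. \<forall>n\<ge>N. dist (p m) (p n) < e" by blast
  qed
  then obtain q where q: "p \<longlonglongrightarrow> q" using Cauchy_convergent convergentD by blast
  have qS: "q \<in> S" using closed_sequentially[OF closed_csubspaceD(1)[OF S]] pS q by blast
  have "(norm (x - q))\<^sup>2 \<le> d\<^sup>2"
  proof (rule LIMSEQ_le)
    show "(\<lambda>n. (norm (x - p n))\<^sup>2) \<longlonglongrightarrow> (norm (x - q))\<^sup>2" by (intro tendsto_intros q)
    show "(\<lambda>n. d\<^sup>2 + inverse (real (Suc n))) \<longlonglongrightarrow> d\<^sup>2" by (rule LIMSEQ_inverse_real_of_nat_add)
  qed (use p less_imp_le in blast)
  then have min: "(norm (x - q))\<^sup>2 \<le> (norm (x - s))\<^sup>2" if "s \<in> S" for s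
    using d_le[OF that] d0 by (meson order_trans power_mono)
  have "cinner (x - q) y = 0" if y: "y \<in> S" for y
  proof -
    define a where "a = cinner (x - q) y"
    \<comment> \<open>Moving \<open>q\<close> by \<open>t * a\<close> times \<open>y\<close> changes
      the squared distance by \<open>t * |a|^2 * (t * |y|^2 - 2)\<close>, which is negative for
      small \<open>t\<close> unless \<open>a = 0\<close>. The \<open>+ 1\<close> covers
      \<open>y = 0\<close> and keeps \<open>t * |y|^2\<close> below 1.\<close>
    define t where "t = inverse ((norm y)\<^sup>2 + 1)"
    have pos: "0 < (norm y)\<^sup>2 + 1" by (simp add: add_nonneg_pos)
    then have t: "0 < t" "t * (norm y)\<^sup>2 < 1"
      by (simp_all add: t_def field_simps)
    let ?c = "complex_of_real t * a"
    have "q + ?c *\<^sub>C y \<in> S" using closed_csubspaceD(3,4)[OF S] qS y by blast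
    from min[OF this] have "(norm (x - q))\<^sup>2 \<le> (norm ((x - q) - ?c *\<^sub>C y))\<^sup>2"
      by (simp add: algebra_simps)
    also have "\<dots> = (norm (x - q))\<^sup>2 + (t * cmod a * norm y)\<^sup>2 - 2 * (t * (cmod a)\<^sup>2)"
    proof -
      have "cinner (x - q) (?c *\<^sub>C y) = complex_of_real t * (cnj a * a)"
        unfolding cinner_scaleC_right a_def[symmetric] by simp
      also have "\<dots> = complex_of_real (t * (cmod a)\<^sup>2)"
        by (metis complex_norm_square mult.commute of_real_mult)
      finally show ?thesis using t
        by (simp add: norm_diff_square norm_scaleC norm_mult)
    qed
    finally have "0 \<le> t * (cmod a)\<^sup>2 * (t * (norm y)\<^sup>2 - 2)"
      by (simp add: power2_eq_square algebra_simps)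
    then have "(cmod a)\<^sup>2 \<le> 0" using t
      by (smt (verit) mult_pos_neg mult_pos_pos)
    then show ?thesis by (simp add: a_def)
  qed
  then show ?thesis using qS by (auto simp: orth_compl_def)
qed

lemma orth_compl_orth_compl:
  assumes "closed_csubspace S"
  shows "orth_compl (orth_compl S) = S"
proof
  show "orth_compl (orth_compl S) \<subseteq> S"
  proof
    fix x assume x: "x \<in> orth_compl (orth_compl S)"
    obtain p where p: "p \<in> S" "x - p \<in> orth_compl S"
      using orthogonal_decomposition[OF assms] by blast
    have "x - p \<in> orth_compl (orth_compl S)"
      using x p(1) subset_orth_compl_orth_compl[of S] closed_csubspaceD(5)[OF closed_csubspace_orth_compl]
      by blast
    with p have "x - p = 0" using orth_compl_Int_self by blast
    with p show "x \<in> S" by simp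
  qed
qed (rule subset_orth_compl_orth_compl)

section \<open>Closed spans and De Morgan laws\<close>

lemma closed_csubspace_closed_cspan [simp]: "closed_csubspace (closed_cspan S)"
proof -
  let ?V = "complex_vector.span S"
  have V: "complex_vector.subspace ?V" by (rule complex_vector.subspace_span)
  have "x + y \<in> closure ?V" if xy: "x \<in> closure ?V" "y \<in> closure ?V" for x y
  proof -
    obtain f where f: "\<forall>n. f n \<in> ?V" "f \<longlonglongrightarrow> x"
      using xy(1) by (auto simp: closure_sequential)
    obtain g where g: "\<forall>n. g n \<in> ?V" "g \<longlonglongrightarrow> y"
      using xy(2) by (auto simp: closure_sequential)
    have "(\<lambda>n. f n + g n) \<longlonglongrightarrow> x + y" by (intro tendsto_intros f g)
    moreover have "\<forall>n. f n + g n \<in> ?V" using f g complex_vector.subspace_add[OF V] by simp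
    ultimately show ?thesis unfolding closure_sequential by (intro exI[of _ "\<lambda>n. f n + g n"] conjI)
  qed
  moreover have "c *\<^sub>C x \<in> closure ?V" if x: "x \<in> closure ?V" for c x
  proof -
    obtain f where f: "\<forall>n. f n \<in> ?V" "f \<longlonglongrightarrow> x"
      using x by (auto simp: closure_sequential)
    have "(\<lambda>n. c *\<^sub>C f n) \<longlonglongrightarrow> c *\<^sub>C x" by (intro scaleC.tendsto tendsto_const f)
    moreover have "\<forall>n. c *\<^sub>C f n \<in> ?V" using f complex_vector.subspace_scale[OF V] by simp
    ultimately show ?thesis unfolding closure_sequential by (intro exI[of _ "\<lambda>n. c *\<^sub>C f n"] conjI)
  qed
  moreover have "0 \<in> closure ?V"
    using V complex_vector.subspace_0 closure_subset by blast
  ultimately show ?thesis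
    by (simp add: closed_csubspace_def closed_cspan_def complex_vector.subspace_def)
qed

lemma closed_cspan_superset: "S \<subseteq> closed_cspan S"
  unfolding closed_cspan_def using closure_subset complex_vector.span_superset by blast

lemma closed_cspan_minimal: "S \<subseteq> T \<Longrightarrow> closed_csubspace T \<Longrightarrow> closed_cspan S \<subseteq> T"
  unfolding closed_cspan_def closed_csubspace_def
  by (simp add: closure_minimal complex_vector.span_minimal)

text \<open>With joins written as double complements, facts about joins reduce to facts about
  intersections; this is how \<open>aff_closed_cspan_UN\<close> obtains joins inside the
  algebra.\<close>

lemma closed_cspan_eq_orth_compl: "closed_cspan S = orth_compl (orth_compl S)"
proof
  show "closed_cspan S \<subseteq> orth_compl (orth_compl S)"
    by (simp add: closed_cspan_minimal subset_orth_compl_orth_compl)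
  show "orth_compl (orth_compl S) \<subseteq> closed_cspan S"
    by (metis closed_cspan_superset closed_csubspace_closed_cspan orth_compl_antimono
        orth_compl_orth_compl)
qed

lemma orth_compl_closed_cspan: "orth_compl (closed_cspan S) = orth_compl S"
  by (simp add: closed_cspan_eq_orth_compl orth_compl_orth_compl)

lemma closed_cspan_mono: "S \<subseteq> T \<Longrightarrow> closed_cspan S \<subseteq> closed_cspan T"
  by (meson closed_cspan_minimal closed_cspan_superset closed_csubspace_closed_cspan order_trans)

lemma closed_cspan_id: "closed_csubspace S \<Longrightarrow> closed_cspan S = S"
  by (simp add: closed_cspan_eq_orth_compl orth_compl_orth_compl)

lemma orth_compl_zero [simp]: "orth_compl {0} = UNIV"
  by (simp add: orth_compl_def cinner.zero_right)

lemma orth_compl_UN: "orth_compl (\<Union>i\<in>I. S i) = (\<Inter>i\<in>I. orth_compl (S i))"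
  by (auto simp: orth_compl_def)

lemma orth_compl_Un: "orth_compl (S \<union> T) = orth_compl S \<inter> orth_compl T"
  by (auto simp: orth_compl_def)

lemma orth_compl_INT:
  assumes "\<And>i. i \<in> I \<Longrightarrow> closed_csubspace (S i)"
  shows "orth_compl (\<Inter>i\<in>I. S i) = closed_cspan (\<Union>i\<in>I. orth_compl (S i))"
  by (simp add: closed_cspan_eq_orth_compl orth_compl_UN orth_compl_orth_compl assms)

section \<open>Orthogonal projections\<close>

lemma bounded_op_linear:
  assumes "bounded_op A"
  shows "bounded_linear A" "A (x + y) = A x + A y" "A (c *\<^sub>C x) = c *\<^sub>C A x" "A (x - y) = A x - A y"
    "A 0 = 0" "A (- x) = - A x"
proof -
  interpret A: bounded_linear A using assms by (simp add: bounded_op_def)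
  show "bounded_linear A" "A (x + y) = A x + A y" "A (x - y) = A x - A y" "A 0 = 0" "A (- x) = - A x"
    by (simp_all add: A.bounded_linear_axioms A.add A.diff A.zero A.neg)
  show "A (c *\<^sub>C x) = c *\<^sub>C A x" using assms by (simp add: bounded_op_def)
qed

lemma is_projectionD:
  assumes P: "is_projection P"
  shows "bounded_op P" "P (P x) = P x" "cinner (P x) y = cinner x (P y)" "x \<in> range P \<longleftrightarrow> P x = x"
    "x - P x \<in> orth_compl (range P)"
proof -
  show "bounded_op P" "P (P x) = P x" and sa: "cinner (P x) y = cinner x (P y)" for x y
    using P by (auto simp: is_projection_def is_adjoint_def fun_eq_iff)
  then show "x \<in> range P \<longleftrightarrow> P x = x" by (metis imageE rangeI)
  show "x - P x \<in> orth_compl (range P)"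
    using \<open>\<And>x. P (P x) = P x\<close> by (auto simp: orth_compl_def cinner.diff_left sa)
qed

lemma is_projection_eqI:
  assumes "is_projection P" "p \<in> range P" "x - p \<in> orth_compl (range P)"
  shows "P x = p"
proof -
  note P = is_projectionD[OF assms(1)]
  have "P (x - p) = 0"
    using assms(3) P(3)[of "x - p" "P (x - p)"] P(2)
    by (metis (mono_tags, lifting) cinner_eq_zero_self mem_Collect_eq orth_compl_def rangeI)
  then show ?thesis using assms(2) P(4) bounded_op_linear(4)[OF P(1)] by simp
qed

lemma closed_csubspace_range_projection:
  assumes "is_projection P"
  shows "closed_csubspace (range P)"
proof -
  note P = is_projectionD[OF assms]
  have "range P = {x. P x = x}" using P(4) by auto
  moreover have "closed {x. P x = x}"
    by (intro closed_Collect_eq continuous_intros linear_continuous_on bounded_op_linear(1)[OF P(1)])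
  ultimately show ?thesis
    by (auto simp: closed_csubspace_def complex_vector.subspace_def bounded_op_linear[OF P(1)])
qed

text \<open>The description repeats the one inside \<open>supp\<close>, so that the support of an
  operator is, by unfolding, \<open>proj\<close> of the orthogonal complement of its kernel.\<close>

definition proj :: "'a::complex_hilbert set \<Rightarrow> 'a \<Rightarrow> 'a" where
  "proj S = (THE P. is_projection P \<and> range P = S)"

lemma proj_range: "is_projection P \<Longrightarrow> proj (range P) = P"
  unfolding proj_def
proof (rule the_equality)
  fix Q assume P: "is_projection P" and Q: "is_projection Q \<and> range Q = range P"
  show "Q = P"
    using is_projection_eqI[of Q] Q is_projectionD(5)[OF P] by fastforce
qed simp

lemma ex_projection:
  assumes S: "closed_csubspace S"
  shows "\<exists>P. is_projection P \<and> range P = S"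
proof -
  obtain P where PS: "\<And>x. P x \<in> S" and Po: "\<And>x. x - P x \<in> orth_compl S"
    using orthogonal_decomposition[OF S] by metis
  have eqI: "P x = p" if "p \<in> S" "x - p \<in> orth_compl S" for x p
  proof -
    have "P x - p \<in> S" using closed_csubspaceD(5)[OF S] PS that by blast
    moreover have "(x - p) - (x - P x) \<in> orth_compl S"
      using closed_csubspaceD(5)[OF closed_csubspace_orth_compl] Po that by blast
    ultimately show ?thesis using orth_compl_Int_self[of "P x - p" S] by simp
  qed
  have add: "P (x + y) = P x + P y" for x y
    using closed_csubspaceD(3)[OF S PS PS] closed_csubspaceD(3)[OF closed_csubspace_orth_compl Po Po]
    by (intro eqI) (auto simp: add_diff_add)
  have scale: "P (c *\<^sub>C x) = c *\<^sub>C P x" for c x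
    using closed_csubspaceD(4)[OF S PS] closed_csubspaceD(4)[OF closed_csubspace_orth_compl Po]
    by (intro eqI) (auto simp flip: scaleC.diff_right)
  have ort: "cinner (P x) (y - P y) = 0" "cinner (y - P y) (P x) = 0" for x y
    using PS Po by (auto simp: orth_compl_def cinner_eq_zero_commute)
  have "norm (P x) \<le> norm x" for x
  proof -
    have "(norm x)\<^sup>2 = (norm (P x))\<^sup>2 + (norm (x - P x))\<^sup>2"
      using norm_add_square[of "P x" "x - P x"] ort by simp
    then show ?thesis by (metis le_add_same_cancel1 norm_ge_zero power2_le_imp_le zero_le_power2)
  qed
  then have "bounded_op P" unfolding bounded_op_def
    by (auto intro!: bounded_linear_intro[where K=1] simp: add scale simp flip: scaleC_of_real)
  moreover have "P x = x" if "x \<in> S" for x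
    using that by (intro eqI) (auto simp: closed_csubspaceD(2))
  then have "P \<circ> P = P" "range P = S" using PS by (auto, metis rangeI)
  moreover have "cinner (P x) y = cinner x (P y)" for x y
    using ort(1)[of x y] ort(2)[of x y] by (simp add: cinner.diff_left cinner.diff_right)
  ultimately show ?thesis unfolding is_projection_def is_adjoint_def by blast
qed

lemma
  assumes "closed_csubspace S"
  shows is_projection_proj: "is_projection (proj S)" and range_proj: "range (proj S) = S"
  using ex_projection[OF assms] proj_range by metis+

lemma proj_basic:
  assumes S: "closed_csubspace S"
  shows "bounded_op (proj S)" "proj S (proj S x) = proj S x" "cinner (proj S x) y = cinner x (proj S y)"
    "x \<in> S \<longleftrightarrow> proj S x = x" "x - proj S x \<in> orth_compl S" "proj S x \<in> S"
  using is_projectionD[OF is_projection_proj[OF S]] range_proj[OF S] by auto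

lemma proj_eqI:
  assumes "closed_csubspace S" "p \<in> S" "x - p \<in> orth_compl S"
  shows "proj S x = p"
  using assms is_projection_eqI is_projection_proj range_proj by metis

lemma proj_orth_compl:
  assumes S: "closed_csubspace S"
  shows "proj (orth_compl S) = (\<lambda>x. x - proj S x)"
  by (rule ext, rule proj_eqI) (simp_all add: orth_compl_orth_compl proj_basic(5,6)[OF S] S)

lemma proj_UNIV: "proj UNIV = id" and proj_zero: "proj {0} = (\<lambda>x. 0)"
  by (rule ext, rule proj_eqI, simp_all add: orth_compl_def cinner.zero_left cinner.zero_right)+

lemma norm_proj_square: "closed_csubspace S \<Longrightarrow> cinner (proj S x) x = complex_of_real ((norm (proj S x))\<^sup>2)"
  by (metis cinner_self proj_basic(2,3))

lemma pythagoras_proj: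
  assumes S: "closed_csubspace S"
  shows "(norm x)\<^sup>2 = (norm (proj S x))\<^sup>2 + (norm (x - proj S x))\<^sup>2"
proof -
  have "cinner (proj S x) (x - proj S x) = 0"
    using proj_basic(5,6)[OF S, of x] by (auto simp: orth_compl_def cinner_eq_zero_commute)
  then show ?thesis using norm_add_square[of "proj S x" "x - proj S x"] by simp
qed

lemma norm_proj_le: "closed_csubspace S \<Longrightarrow> norm (proj S x) \<le> norm x"
  using pythagoras_proj[of S x] by (smt (verit) norm_ge_zero power2_le_imp_le zero_le_power2)

lemma norm_diff_proj_le:
  assumes S: "closed_csubspace S" and z: "z \<in> S"
  shows "norm (x - proj S x) \<le> norm (x - z)"
proof -
  have "proj S (x - z) = proj S x - z"
    using bounded_op_linear(4)[OF proj_basic(1)[OF S]] z proj_basic(4)[OF S] by simp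
  then show ?thesis using pythagoras_proj[OF S, of "x - z"]
    by (simp add: power2_le_imp_le)
qed

lemma proj_proj:
  assumes S: "closed_csubspace S" and T: "closed_csubspace T" and "S \<subseteq> T"
  shows "proj S (proj T x) = proj S x"
proof -
  have "x - proj T x \<in> orth_compl S" using proj_basic(5)[OF T] orth_compl_antimono[OF \<open>S \<subseteq> T\<close>] by blast
  then have "proj S (x - proj T x) = 0"
    by (intro proj_eqI) (auto simp: S closed_csubspaceD(2))
  then show ?thesis using bounded_op_linear(4)[OF proj_basic(1)[OF S]] by simp
qed

lemma bounded_op_diff: "bounded_op A \<Longrightarrow> bounded_op B \<Longrightarrow> bounded_op (\<lambda>x. A x - B x)"
  unfolding bounded_op_def by (auto intro: bounded_linear_sub simp: scaleC.diff_right)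

text \<open>For \<open>x\<close> in \<open>S\<close> the quadratic forms give
  \<open>norm x \<le> norm (proj T x)\<close>, and Pythagoras then leaves no room for
  \<open>x - proj T x\<close>. The operator order on projections can henceforth be read as
  inclusion.\<close>

lemma op_le_proj_iff:
  assumes S: "closed_csubspace S" and T: "closed_csubspace T"
  shows "op_le (proj S) (proj T) \<longleftrightarrow> S \<subseteq> T"
proof
  assume le: "op_le (proj S) (proj T)"
  show "S \<subseteq> T"
  proof
    fix x assume x: "x \<in> S"
    have "cinner (proj T x - proj S x) x \<in> \<real>\<^sub>\<ge>\<^sub>0" using le by (auto simp: op_le_def positive_op_def)
    then have "(norm (proj S x))\<^sup>2 \<le> (norm (proj T x))\<^sup>2"
      by (simp add: cinner.diff_left norm_proj_square S T complex_nonneg_Reals_iff del: of_real_power)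
    moreover have "proj S x = x" using x proj_basic(4)[OF S] by simp
    ultimately have "x - proj T x = 0" using pythagoras_proj[OF T, of x] by simp
    then show "x \<in> T" using proj_basic(4)[OF T] by simp
  qed
next
  assume "S \<subseteq> T"
  have "(norm (proj S x))\<^sup>2 \<le> (norm (proj T x))\<^sup>2" for x
    using norm_proj_le[OF S, of "proj T x"] by (simp add: proj_proj[OF S T \<open>S \<subseteq> T\<close>] power_mono)
  then show "op_le (proj S) (proj T)"
    unfolding op_le_def positive_op_def
    by (auto simp: bounded_op_diff proj_basic(1) S T cinner.diff_left norm_proj_square
        complex_nonneg_Reals_iff simp del: of_real_power)
qed

text \<open>The union of a chain is already a subspace, so its closed span is a mere closure: every
  point \<open>y\<close> of it is close to a point of some \<open>S N\<close>, and the projections,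
  being best approximations, do at least as well from \<open>N\<close> on. A general
  \<open>x\<close> is first replaced by its projection \<open>y\<close> onto the closed
  span.\<close>

lemma proj_increasing_tendsto:
  fixes S :: "nat \<Rightarrow> 'a::complex_hilbert set"
  assumes S: "\<And>n. closed_csubspace (S n)" and inc: "incseq S"
  shows "(\<lambda>n. proj (S n) x) \<longlonglongrightarrow> proj (closed_cspan (\<Union>n. S n)) x"
proof -
  let ?T = "closed_cspan (\<Union>n. S n)"
  define y where "y = proj ?T x"
  have sub: "S n \<subseteq> ?T" for n using closed_cspan_superset[of "\<Union>n. S n"] by blast
  have add: "x + y \<in> (\<Union>n. S n)" if "x \<in> S m" "y \<in> S n" for x y m n
  proof -
    have "x \<in> S (max m n)" "y \<in> S (max m n)"
      using that incseqD[OF inc, of m "max m n"] incseqD[OF inc, of n "max m n"] by auto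
    then show "x + y \<in> (\<Union>n. S n)" using closed_csubspaceD(3)[OF S] by blast
  qed
  have "complex_vector.subspace (\<Union>n. S n)"
    unfolding complex_vector.subspace_def
    by (auto intro: closed_csubspaceD(2,4)[OF S] dest: add)
  then have T: "?T = closure (\<Union>n. S n)"
    by (simp add: closed_cspan_def complex_vector.span_eq_iff[THEN iffD2])
  have "(\<lambda>n. proj (S n) y) \<longlonglongrightarrow> y"
  proof (rule metric_LIMSEQ_I)
    fix r :: real assume "0 < r"
    moreover have "y \<in> closure (\<Union>n. S n)" using proj_basic(6)[OF closed_csubspace_closed_cspan, of "\<Union>n. S n" x] T by (simp add: y_def)
    ultimately obtain z where z: "z \<in> (\<Union>n. S n)" "dist z y < r" using closure_approachable by blast
    then obtain N where "z \<in> S N" by blast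
    then have "dist (proj (S n) y) y < r" if "n \<ge> N" for n
      using norm_diff_proj_le[OF S, of z n y] incseqD[OF inc that] z(2)
      by (metis dist_commute dist_norm in_mono order_le_less_trans)
    then show "\<exists>N. \<forall>n\<ge>N. dist (proj (S n) y) y < r" by blast
  qed
  then show ?thesis by (simp add: y_def proj_proj S sub)
qed

section \<open>Adjoints and the bicommutant\<close>

lemma riesz_representation:
  fixes f :: "'a::complex_hilbert \<Rightarrow> complex"
  assumes f: "bounded_linear f" and scale: "\<And>c x. f (c *\<^sub>C x) = c * f x"
  shows "\<exists>y. \<forall>x. f x = cinner x y"
proof -
  interpret f: bounded_linear f by fact
  let ?N = "{x. f x = 0}"
  have "closed ?N"
    by (intro closed_Collect_eq continuous_intros linear_continuous_on f)
  then have N: "closed_csubspace ?N"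
    by (simp add: closed_csubspace_def complex_vector.subspace_def f.add f.zero scale)
  show ?thesis
  proof (cases "\<exists>x. f x \<noteq> 0")
    case True
    then obtain x0 where x0: "f x0 \<noteq> 0" by blast
    obtain p where p: "f p = 0" "x0 - p \<in> orth_compl ?N"
      using orthogonal_decomposition[OF N, of x0] by blast
    define z where "z = x0 - p"
    have fz: "f z \<noteq> 0" using p(1) x0 by (simp add: z_def f.diff)
    then have z: "cinner z z \<noteq> 0" by (auto simp: f.zero)
    \<comment> \<open>The kernel of \<open>f\<close> has codimension one:
      \<open>f z *\<^sub>C x - f x *\<^sub>C z\<close> lies in it and is therefore orthogonal to
      \<open>z\<close>. Solving for \<open>f x\<close> gives the coefficient.\<close>
    have "f x = cinner x ((cnj (f z) / cinner z z) *\<^sub>C z)" for x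
    proof -
      have "f (f z *\<^sub>C x - f x *\<^sub>C z) = 0" by (simp add: f.diff scale)
      then have "cinner (f z *\<^sub>C x - f x *\<^sub>C z) z = 0"
        using p(2) cinner_eq_zero_commute by (auto simp: orth_compl_def z_def)
      then have "f z * cinner x z = f x * cinner z z"
        by (simp add: cinner.diff_left cinner_scaleC_left)
      moreover have "cnj (cinner z z) = cinner z z" by (metis cinner_commute)
      ultimately show ?thesis using z by (simp add: cinner_scaleC_right field_simps)
    qed
    then show ?thesis by blast
  qed (auto intro: exI[of _ 0] simp: cinner.zero_right)
qed

lemma is_adjoint_sym: "is_adjoint A B \<Longrightarrow> is_adjoint B A"
  unfolding is_adjoint_def by (metis cinner_commute)

lemma is_adjointD: "is_adjoint A B \<Longrightarrow> cinner (A x) y = cinner x (B y)"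
  unfolding is_adjoint_def by blast

lemma bounded_op_adjoint:
  assumes A: "bounded_op A" and adj: "is_adjoint A B"
  shows "bounded_op B"
proof -
  note B = is_adjointD[OF is_adjoint_sym[OF adj]]
  have add: "B (x + y) = B x + B y" for x y
    by (rule cinner_ext) (simp add: B cinner_add_left)
  have scale: "B (c *\<^sub>C x) = c *\<^sub>C B x" for c x
    by (rule cinner_ext) (simp add: B cinner_scaleC_left)
  obtain K where K: "\<And>x. norm (A x) \<le> norm x * K" and "0 < K"
    using bounded_linear.pos_bounded[OF bounded_op_linear(1)[OF A]] by blast
  have "norm (B x) \<le> norm x * K" for x
  proof (cases "B x = 0")
    case False
    have "(norm (B x))\<^sup>2 = cmod (cinner (B x) (B x))" by (simp add: cinner_self norm_power)
    also have "\<dots> = cmod (cinner x (A (B x)))" by (simp add: B)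
    also have "\<dots> \<le> norm x * norm (A (B x))" by (rule norm_cinner_le)
    also have "\<dots> \<le> norm x * (norm (B x) * K)" by (simp add: K mult_left_mono)
    finally show ?thesis using False by (simp add: power2_eq_square mult_ac)
  qed (use \<open>0 < K\<close> in simp)
  then show ?thesis unfolding bounded_op_def
    by (auto intro!: bounded_linear_intro[where K=K] simp: add scale simp flip: scaleC_of_real)
qed

lemma ex_adjoint:
  assumes A: "bounded_op A"
  shows "\<exists>B. bounded_op B \<and> is_adjoint A B"
proof -
  have "\<exists>z. \<forall>x. cinner (A x) y = cinner x z" for y
    using bounded_linear_compose[OF cinner.bounded_linear_left bounded_op_linear(1)[OF A]]
    by (intro riesz_representation) (auto simp: bounded_op_linear[OF A] cinner_scaleC_left)
  then obtain B where "\<And>x y. cinner (A x) y = cinner x (B y)" by metis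
  then have "is_adjoint A B" by (simp add: is_adjoint_def)
  then show ?thesis using bounded_op_adjoint[OF A] by blast
qed

section \<open>Bounded operators, commutants and the Cayley transform\<close>

lemma bounded_op_id [simp]: "bounded_op id" "bounded_op (\<lambda>x. x)"
  and bounded_op_zero [simp]: "bounded_op (\<lambda>x. 0)"
  by (simp_all add: bounded_op_def bounded_linear_ident id_def)

lemma bounded_op_add: "bounded_op A \<Longrightarrow> bounded_op B \<Longrightarrow> bounded_op (\<lambda>x. A x + B x)"
  unfolding bounded_op_def by (auto intro: bounded_linear_add simp: scaleC_add_right)

lemma bounded_op_scaleC: "bounded_op A \<Longrightarrow> bounded_op (\<lambda>x. c *\<^sub>C A x)"
  unfolding bounded_op_def
  by (auto intro: bounded_linear_compose[OF scaleC.bounded_linear_right] simp: scaleC_scaleC mult.commute)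

lemma bounded_op_comp: "bounded_op A \<Longrightarrow> bounded_op B \<Longrightarrow> bounded_op (A \<circ> B)"
  unfolding bounded_op_def by (auto intro: bounded_linear_compose simp: comp_def)

lemma bounded_op_funpow: "bounded_op A \<Longrightarrow> bounded_op (A ^^ n)"
  by (induction n) (auto intro: bounded_op_comp)

lemma in_commutant_iff: "A \<in> commutant S \<longleftrightarrow> bounded_op A \<and> (\<forall>B\<in>S. \<forall>x. A (B x) = B (A x))"
  by (auto simp: commutant_def fun_eq_iff)

lemma commutant_adjoint:
  assumes star: "\<And>B. B \<in> S \<Longrightarrow> \<exists>B'\<in>S. is_adjoint B B'"
    and A: "A \<in> commutant S" and adj: "is_adjoint A A'"
  shows "A' \<in> commutant S"
proof -
  have "A' (B x) = B (A' x)" if B: "B \<in> S" for B x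
  proof (rule cinner_ext)
    fix z
    obtain B' where B': "B' \<in> S" "is_adjoint B B'" using star B by blast
    have "cinner (A' (B x)) z = cinner x (B' (A z))"
      by (metis B'(2) adj is_adjointD is_adjoint_sym)
    also have "B' (A z) = A (B' z)" using A B' by (simp add: in_commutant_iff)
    also have "cinner x (A (B' z)) = cinner (B (A' x)) z"
      by (metis B'(2) adj is_adjointD is_adjoint_sym)
    finally show "cinner (A' (B x)) z = cinner (B (A' x)) z" .
  qed
  then show ?thesis
    using A bounded_op_adjoint[OF _ adj] by (simp add: in_commutant_iff)
qed

text \<open>The scalar stands for \<open>\<i>\<close> or its conjugate. For self-adjoint
  \<open>A\<close> the cross term is then purely imaginary and drops out, so \<open>1 + c A\<close>
  is bounded below by 1.\<close>

lemma norm_add_scaled_selfadjoint: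
  assumes A: "is_adjoint A A" and c: "cnj c = - c" "cmod c = 1"
  shows "(norm (x + c *\<^sub>C A x))\<^sup>2 = (norm x)\<^sup>2 + (norm (A x))\<^sup>2"
proof -
  have "cnj (cinner x (A x)) = cinner x (A x)"
    by (metis A cinner_commute is_adjointD)
  then have "cnj (cinner x (c *\<^sub>C A x)) = - cinner x (c *\<^sub>C A x)"
    using c by (simp add: cinner_scaleC_right)
  then have "Re (cinner x (c *\<^sub>C A x)) = 0"
    by (metis complex_cnj(1) complex_cnj cnj.sel(1) uminus_complex.sel(1) equation_minus_iff
        add.inverse_neutral eq_neg_iff_add_eq_0 double_zero)
  then show ?thesis by (simp add: norm_add_square norm_scaleC c power_mult_distrib)
qed

lemma subspace_range_bounded_op:
  assumes "bounded_op A"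
  shows "complex_vector.subspace (range A)"
  unfolding complex_vector.subspace_def
proof (intro conjI ballI allI)
  note A = bounded_op_linear[OF assms]
  show "0 \<in> range A" using rangeI[of A 0] by (simp add: A(5))
  show "u + v \<in> range A" if "u \<in> range A" "v \<in> range A" for u v
    using that rangeI[of A] by (auto simp flip: A(2))
  show "k *\<^sub>C u \<in> range A" if "u \<in> range A" for k u
    using that rangeI[of A] by (auto simp flip: A(3))
qed

text \<open>Being bounded below by 1, the operator is injective with complete, hence closed, range.
  The orthogonal complement of the range is killed by the adjoint, which has the same form with the
  conjugate scalar and is bounded below as well; so the range is everything.\<close>

lemma bij_add_scaled_selfadjoint:
  assumes bA: "bounded_op A" and A: "is_adjoint A A" and c: "cnj c = - c" "cmod c = 1"
  shows "bij (\<lambda>x. x + c *\<^sub>C A x)"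
proof -
  let ?B = "\<lambda>x. x + c *\<^sub>C A x"
  have B: "bounded_op ?B" by (intro bounded_op_add bounded_op_scaleC bA bounded_op_id)
  have bound: "norm x \<le> norm (?B x)" for x
    using norm_add_scaled_selfadjoint[OF A c, of x] by (smt (verit) norm_ge_zero power2_le_imp_le zero_le_power2)
  have "inj ?B"
  proof (rule injI)
    fix x y assume "?B x = ?B y"
    then have "?B (x - y) = 0" using bounded_op_linear(4)[OF B, of x y] by simp
    then show "x = y" using bound[of "x - y"] by simp
  qed
  moreover have "range ?B = UNIV"
  proof -
    have "complete (?B ` UNIV)"
      using bound bounded_op_linear(1)[OF B]
      by (intro complete_isometric_image[where e=1]) (auto simp: complete_UNIV)
    then have "closed (range ?B)" by (rule complete_imp_closed)
    moreover have "complex_vector.subspace (range ?B)"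
      by (rule subspace_range_bounded_op[OF B])
    ultimately have cl: "closed_csubspace (range ?B)" by (simp add: closed_csubspace_def)
    have "y = 0" if y: "y \<in> orth_compl (range ?B)" for y
    proof -
      have "cinner (y + cnj c *\<^sub>C A y) x = 0" for x
      proof -
        have "cinner (y + cnj c *\<^sub>C A y) x = cinner y (?B x)"
          by (simp add: cinner_add_left cinner_add_right cinner_scaleC_left cinner_scaleC_right is_adjointD[OF A])
        then show ?thesis using y by (auto simp: orth_compl_def)
      qed
      then have "y + cnj c *\<^sub>C A y = 0" using cinner_eq_zero_self by blast
      moreover have "cnj (cnj c) = - cnj c" "cmod (cnj c) = 1" using c by simp_all
      ultimately show "y = 0" using norm_add_scaled_selfadjoint[OF A, of "cnj c" y] by simp
    qed
    then have "orth_compl (range ?B) = {0}"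
      using closed_csubspaceD(2)[OF closed_csubspace_orth_compl] by blast
    then show ?thesis using orth_compl_orth_compl[OF cl] by simp
  qed
  ultimately show ?thesis by (simp add: bij_def)
qed

text \<open>The Cayley transform \<open>(1 - \<i>A)(1 + \<i>A)\<inverse>\<close> is a unitary in the commutant from which \<open>A\<close> can be
  recovered, so an operator commuting with the unitaries of a commutant commutes with all its
  self-adjoint elements.\<close>

lemma commutes_with_selfadjoint:
  assumes comm: "\<And>U. U \<in> commutant S \<Longrightarrow> is_unitary U \<Longrightarrow> U \<circ> P = P \<circ> U"
    and S: "\<And>C. C \<in> S \<Longrightarrow> bounded_op C"
    and P: "bounded_op P" and A: "A \<in> commutant S" "is_adjoint A A"
  shows "A (P x) = P (A x)"
proof -
  have bA: "bounded_op A" using A by (simp add: in_commutant_iff)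
  define B where "B = (\<lambda>x. x + \<i> *\<^sub>C A x)"
  define D where "D = (\<lambda>x. x - \<i> *\<^sub>C A x)"
  have D_alt: "D = (\<lambda>x. x + (- \<i>) *\<^sub>C A x)" by (simp add: D_def scaleC.minus_left)
  have B: "bij B" and D: "bij D"
    unfolding B_def D_alt by (rule bij_add_scaled_selfadjoint[OF bA A(2)]; simp)+
  have bB: "bounded_op B" and bD: "bounded_op D" unfolding B_def D_def
    by (intro bounded_op_add bounded_op_diff bounded_op_scaleC bA bounded_op_id)+
  note A_lin = bounded_op_linear[OF bA] and P_lin = bounded_op_linear[OF P]
  have BD: "B (D y) = D (B y)" for y
    by (simp add: B_def D_def A_lin scaleC_add_right scaleC.diff_right)
  have adj: "is_adjoint B D"
    by (simp add: B_def D_def is_adjoint_def cinner_add_left cinner.diff_right cinner_scaleC_left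
        cinner_scaleC_right is_adjointD[OF A(2)])
  define V where "V = inv B"
  define V' where "V' = inv D"
  have VB: "V (B y) = y" "B (V y) = y" and VD: "V' (D y) = y" "D (V' y) = y" for y
    unfolding V_def V'_def using B D by (simp_all add: bij_is_inj bij_is_surj surj_f_inv_f inv_f_f)
  define U where "U = (\<lambda>y. D (V y))"
  \<comment> \<open>In this form, commuting with \<open>U\<close> amounts to commuting with
    \<open>V\<close>, the inverse of \<open>B\<close>, hence with \<open>B\<close> and with
    \<open>A\<close>.\<close>
  have U_eq: "U y = 2 *\<^sub>R V y - y" for y
  proof -
    have "D (V y) = 2 *\<^sub>R V y - B (V y)" by (simp add: B_def D_def scaleR_2)
    then show ?thesis by (simp only: U_def VB)
  qed
  have adjU: "is_adjoint U (\<lambda>y. B (V' y))"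
    unfolding is_adjoint_def U_def
  proof (intro allI)
    fix y z
    have "cinner (D (V y)) z = cinner (D (V y)) (D (V' z))" by (simp only: VD)
    also have "\<dots> = cinner (V y) (B (D (V' z)))"
      by (rule is_adjointD[OF is_adjoint_sym[OF adj]])
    also have "\<dots> = cinner (V y) (D (B (V' z)))" by (simp only: BD)
    also have "\<dots> = cinner (B (V y)) (B (V' z))" by (rule is_adjointD[OF adj, symmetric])
    finally show "cinner (D (V y)) z = cinner y (B (V' z))" by (simp only: VB)
  qed
  have V_bound: "norm (V y) \<le> norm y" for y
  proof -
    have "(norm (B (V y)))\<^sup>2 = (norm (V y))\<^sup>2 + (norm (A (V y)))\<^sup>2"
      unfolding B_def by (rule norm_add_scaled_selfadjoint[OF A(2)]) simp_all
    then show ?thesis unfolding VB by (simp add: power2_le_imp_le)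
  qed
  have V_lin: "V (y + z) = V y + V z" "V (c *\<^sub>C y) = c *\<^sub>C V y" for y z c
    using bounded_op_linear(2,3)[OF bB] VB by metis+
  have bV: "bounded_op V" unfolding bounded_op_def
    using V_bound by (auto intro!: bounded_linear_intro[where K=1] simp: V_lin simp flip: scaleC_of_real)
  have bU: "bounded_op U" using bounded_op_comp[OF bD bV] by (simp add: comp_def U_def)
  have "is_unitary U" unfolding is_unitary_def
    using bU adjU by (auto simp: fun_eq_iff U_def VB VD intro!: exI[of _ "\<lambda>y. B (V' y)"])
  moreover have "U \<in> commutant S"
    unfolding in_commutant_iff
  proof (intro conjI ballI allI bU)
    fix C y assume C: "C \<in> S"
    note C_lin = bounded_op_linear[OF S[OF C]]
    have AC: "A (C z) = C (A z)" for z using A(1) C by (simp add: in_commutant_iff)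
    have "B (C (V y)) = C (B (V y))" by (simp only: B_def C_lin AC)
    then have "V (C y) = C (V y)" by (metis VB)
    then show "U (C y) = C (U y)" by (simp only: U_def D_def C_lin AC)
  qed
  ultimately have "U \<circ> P = P \<circ> U" using comm by blast
  then have "U (P y) = P (U y)" for y by (metis comp_apply)
  then have "V (P y) = P (V y)" for y
    by (simp add: U_eq P_lin scaleC_of_real[symmetric])
  then have "P (B x) = B (P x)" using VB by metis
  then have "\<i> *\<^sub>C A (P x) = \<i> *\<^sub>C P (A x)" by (simp add: B_def P_lin)
  then show ?thesis by simp
qed

text \<open>Affiliation tests only the unitaries of the commutant, whereas the bicommutant condition
  tests all its elements. The bridge is to write \<open>2 C\<close> as the sum of
  \<open>C + C'\<close> and \<open>C - C'\<close>: the first, and \<open>\<i>\<close> times the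
  second, are self-adjoint elements of the commutant, to which
  \<open>commutes_with_selfadjoint\<close> applies.\<close>

lemma in_von_neumann_algebra_if_commutes_with_unitaries:
  assumes M: "von_neumann_algebra M" and P: "bounded_op P"
    and comm: "\<And>U. U \<in> commutant M \<Longrightarrow> is_unitary U \<Longrightarrow> U \<circ> P = P \<circ> U"
  shows "P \<in> M"
proof -
  have "P (C x) = C (P x)" if C: "C \<in> commutant M" for C x
  proof -
    have bC: "bounded_op C" using C by (simp add: in_commutant_iff)
    obtain C' where bC': "bounded_op C'" and adj: "is_adjoint C C'" using ex_adjoint[OF bC] by blast
    have C': "C' \<in> commutant M"
      using commutant_adjoint[OF _ C adj] M by (auto simp: von_neumann_algebra_def)
    note adj' = is_adjoint_sym[OF adj]
    let ?A1 = "\<lambda>x. C x + C' x" and ?A2 = "\<lambda>x. \<i> *\<^sub>C (C x - C' x)"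
    have lin: "B (x + y) = B x + B y" "B (x - y) = B x - B y" "B (c *\<^sub>C x) = c *\<^sub>C B x"
      if "B \<in> M" for B x y c
      using bounded_op_linear(2-4) M that unfolding von_neumann_algebra_def by blast+
    have "?A1 \<in> commutant M" "?A2 \<in> commutant M"
      using C C' bC bC' lin by (auto simp: in_commutant_iff intro!: bounded_op_add bounded_op_scaleC bounded_op_diff)
    moreover have "is_adjoint ?A1 ?A1"
      by (simp add: is_adjoint_def cinner_add_left cinner_add_right is_adjointD[OF adj] is_adjointD[OF adj'])
    moreover have "is_adjoint ?A2 ?A2"
      by (simp add: is_adjoint_def cinner_scaleC_left cinner_scaleC_right cinner.diff_left cinner.diff_right
          is_adjointD[OF adj] is_adjointD[OF adj'] algebra_simps)
    moreover have "A (P x) = P (A x)" if "A \<in> commutant M" "is_adjoint A A" for A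
      using that commutes_with_selfadjoint[OF comm _ P] M unfolding von_neumann_algebra_def by simp
    ultimately have 1: "C (P x) + C' (P x) = P (C x + C' x)"
      and 2: "\<i> *\<^sub>C (C (P x) - C' (P x)) = P (\<i> *\<^sub>C (C x - C' x))"
      by blast+
    from 2 have "C (P x) - C' (P x) = P (C x - C' x)"
      by (simp add: bounded_op_linear[OF P])
    with 1 have "(C (P x) + C' (P x)) + (C (P x) - C' (P x)) = P (C x + C' x) + P (C x - C' x)"
      by (simp only:)
    then have "2 *\<^sub>R C (P x) = 2 *\<^sub>R P (C x)"
      by (simp add: bounded_op_linear[OF P] scaleR_2)
    then show ?thesis by simp
  qed
  then have "P \<in> commutant (commutant M)" using P by (simp add: in_commutant_iff)
  then show ?thesis using M by (simp add: von_neumann_algebra_def)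
qed

section \<open>Powers of self-adjoint contractions\<close>

lemma selfadjoint_funpow: "is_adjoint A A \<Longrightarrow> cinner ((A ^^ k) x) y = cinner x ((A ^^ k) y)"
  by (induction k arbitrary: x y) (simp_all add: is_adjointD funpow_swap1)

lemma contraction_adjoint:
  assumes "is_adjoint A B" "\<And>x. norm (A x) \<le> norm x"
  shows "norm (B x) \<le> norm x"
proof (cases "B x = 0")
  case False
  have "(norm (B x))\<^sup>2 = cmod (cinner (B x) (B x))" by (simp add: cinner_self norm_power)
  also have "cinner (B x) (B x) = cinner (A (B x)) x" by (simp add: is_adjointD[OF assms(1)])
  also have "cmod \<dots> \<le> norm (A (B x)) * norm x" by (rule norm_cinner_le)
  also have "\<dots> \<le> norm (B x) * norm x" by (simp add: assms(2) mult_right_mono)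
  finally show ?thesis using False by (simp add: power2_eq_square)
qed simp

lemma op_le_lim:
  assumes "bounded_op A" "bounded_op B" "\<And>x. X x \<longlonglongrightarrow> B x"
    and "\<And>x. \<forall>\<^sub>F n in sequentially. cinner (X x n - A x) x \<in> \<real>\<^sub>\<ge>\<^sub>0"
  shows "op_le A B"
  unfolding op_le_def positive_op_def
proof (intro conjI allI)
  fix x
  have "(\<lambda>n. cinner (X x n - A x) x) \<longlonglongrightarrow> cinner (B x - A x) x"
    by (intro cinner.tendsto tendsto_diff assms tendsto_const)
  then show "cinner (B x - A x) x \<in> \<real>\<^sub>\<ge>\<^sub>0"
    using Lim_in_closed_set[OF closed_nonneg_Reals_complex assms(4)] by simp
qed (simp add: assms bounded_op_diff)

lemma positive_op_proj: "closed_csubspace S \<Longrightarrow> positive_op (proj S)"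
  by (simp add: positive_op_def proj_basic(1) norm_proj_square complex_nonneg_Reals_iff)

text \<open>The squared norms \<open>a n\<close> of \<open>(C ^^ n) x\<close> decrease and so
  converge, while self-adjointness turns the inner product of the powers \<open>2 * m\<close> and
  \<open>2 * n\<close> into \<open>a (m + n)\<close>. Distances between even powers are thus
  controlled by \<open>a\<close>. Odd powers would be spoiled by an eigenvalue -1, which is why the
  limit projects onto the fixed points of \<open>C\<close> applied twice.\<close>

lemma selfadjoint_contraction_powers_tendsto:
  assumes C: "bounded_op C" "is_adjoint C C" and contr: "\<And>x. norm (C x) \<le> norm x"
  shows "closed_csubspace {x. C (C x) = x}"
    and "(\<lambda>n. (C ^^ (2 * n)) x) \<longlonglongrightarrow> proj {x. C (C x) = x} x"
proof -
  let ?S = "{x. C (C x) = x}"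
  note lin = bounded_op_linear[OF C(1)]
  have "closed ?S"
    by (intro closed_Collect_eq continuous_intros linear_continuous_on bounded_linear_compose[OF lin(1) lin(1)])
  then show S: "closed_csubspace ?S"
    by (simp add: closed_csubspace_def complex_vector.subspace_def lin)
  note pow_adj = selfadjoint_funpow[OF C(2)]
  define a where "a n = (norm ((C ^^ n) x))\<^sup>2" for n
  have "decseq a" unfolding a_def by (rule decseq_SucI) (simp add: contr power_mono)
  moreover have "bdd_below (range a)" by (auto intro!: bdd_belowI[of _ 0] simp: a_def)
  ultimately have "convergent a"
    using decseq_convergent[of a 0] by (auto simp: convergent_def a_def)
  then have "Cauchy a" by (rule convergent_Cauchy)
  have dist_sq: "(norm ((C ^^ (2 * m)) x - (C ^^ (2 * n)) x))\<^sup>2 = (a (2 * m) - a (m + n)) + (a (2 * n) - a (m + n))" for m n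
  proof -
    have "cinner ((C ^^ (2 * m)) x) ((C ^^ (2 * n)) x) = cinner ((C ^^ m) ((C ^^ m) x)) ((C ^^ n) ((C ^^ n) x))"
      by (simp add: mult_2 funpow_add)
    also have "\<dots> = cinner ((C ^^ n) ((C ^^ m) x)) ((C ^^ m) ((C ^^ n) x))"
      by (metis add.commute comp_apply funpow_add pow_adj)
    also have "\<dots> = cinner ((C ^^ (m + n)) x) ((C ^^ (m + n)) x)"
      by (metis add.commute comp_apply funpow_add)
    finally show ?thesis by (simp add: norm_diff_square a_def cinner_self)
  qed
  have "Cauchy (\<lambda>n. (C ^^ (2 * n)) x)"
  proof (rule metric_CauchyI)
    fix e :: real assume e: "0 < e"
    then have "0 < e\<^sup>2 / 2" by simp
    from metric_CauchyD[OF \<open>Cauchy a\<close> this]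
    obtain N where N: "\<And>m n. m \<ge> N \<Longrightarrow> n \<ge> N \<Longrightarrow> \<bar>a m - a n\<bar> < e\<^sup>2 / 2"
      unfolding dist_real_def by blast
    have "dist ((C ^^ (2 * m)) x) ((C ^^ (2 * n)) x) < e" if "m \<ge> N" "n \<ge> N" for m n
    proof -
      have "\<bar>a (2 * m) - a (m + n)\<bar> < e\<^sup>2 / 2" "\<bar>a (2 * n) - a (m + n)\<bar> < e\<^sup>2 / 2"
        using N[of "2 * m" "m + n"] N[of "2 * n" "m + n"] that by simp_all
      then have "(norm ((C ^^ (2 * m)) x - (C ^^ (2 * n)) x))\<^sup>2 < e\<^sup>2"
        unfolding dist_sq by linarith
      then show ?thesis using e by (simp add: dist_norm power_less_imp_less_base)
    qed
    then show "\<exists>N. \<forall>m\<ge>N. \<forall>n\<ge>N. dist ((C ^^ (2 * m)) x) ((C ^^ (2 * n)) x) < e" by blast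
  qed
  then obtain y where y: "(\<lambda>n. (C ^^ (2 * n)) x) \<longlonglongrightarrow> y" using Cauchy_convergent convergentD by blast
  have "(\<lambda>n. C (C ((C ^^ (2 * n)) x))) \<longlonglongrightarrow> C (C y)"
    by (intro bounded_linear.tendsto[OF lin(1)] y)
  moreover have "(\<lambda>n. C (C ((C ^^ (2 * n)) x))) \<longlonglongrightarrow> y"
    using LIMSEQ_Suc[OF y] by simp
  ultimately have "y \<in> ?S" using LIMSEQ_unique by blast
  moreover have "x - y \<in> orth_compl ?S"
    unfolding orth_compl_def
  proof (intro CollectI ballI)
    fix s assume s: "s \<in> ?S"
    have "(C ^^ (2 * n)) s = s" for n using s by (induction n) simp_all
    then have "cinner ((C ^^ (2 * n)) x) s = cinner x s" for n by (simp add: pow_adj)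
    moreover have "(\<lambda>n. cinner ((C ^^ (2 * n)) x) s) \<longlonglongrightarrow> cinner y s"
      by (intro cinner.tendsto y tendsto_const)
    ultimately have "cinner y s = cinner x s" by (simp add: LIMSEQ_const_iff)
    then show "cinner (x - y) s = 0" by (simp add: cinner.diff_left)
  qed
  ultimately have "proj ?S x = y" using proj_eqI[OF S] by blast
  with y show "(\<lambda>n. (C ^^ (2 * n)) x) \<longlonglongrightarrow> proj ?S x" by simp
qed

section \<open>Subspaces affiliated with a von Neumann algebra\<close>

definition aff_subspace :: "('a::complex_hilbert \<Rightarrow> 'a) set \<Rightarrow> 'a set \<Rightarrow> bool" where
  "aff_subspace M S \<longleftrightarrow> closed_csubspace S \<and> proj S \<in> M"

lemma unitary_commutant_inverse:
  assumes star: "\<And>B. B \<in> S \<Longrightarrow> \<exists>B'\<in>S. is_adjoint B B'"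
    and U: "U \<in> commutant S" "is_unitary U"
  obtains V where "V \<in> commutant S" "is_unitary V" "is_adjoint U V" "\<And>x. V (U x) = x" "\<And>x. U (V x) = x"
proof -
  obtain V where V: "is_adjoint U V" "V \<circ> U = id" "U \<circ> V = id"
    using U(2) by (auto simp: is_unitary_def)
  have VS: "V \<in> commutant S" by (rule commutant_adjoint[OF star U(1) V(1)])
  then have "is_unitary V"
    using V is_adjoint_sym[OF V(1)] by (auto simp: is_unitary_def in_commutant_iff)
  then show thesis using that VS V by (metis comp_apply id_apply)
qed

locale vna =
  fixes M :: "('a::complex_hilbert \<Rightarrow> 'a) set"
  assumes von_neumann: "von_neumann_algebra M"
begin

lemma in_iff: "A \<in> M \<longleftrightarrow> bounded_op A \<and> (\<forall>B\<in>commutant M. \<forall>x. A (B x) = B (A x))"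
  using von_neumann in_commutant_iff[of A "commutant M"] by (simp add: von_neumann_algebra_def)

lemma bounded: "A \<in> M \<Longrightarrow> bounded_op A"
  by (simp add: in_iff)

lemma star_closed: "A \<in> M \<Longrightarrow> \<exists>B\<in>M. is_adjoint A B"
  using von_neumann by (simp add: von_neumann_algebra_def)

lemma commutant_linear:
  assumes "B \<in> commutant M"
  shows "B (x + y) = B x + B y" "B (c *\<^sub>C x) = c *\<^sub>C B x" "B (x - y) = B x - B y" "B 0 = 0"
  using assms bounded_op_linear unfolding in_commutant_iff by blast+

lemma id_in: "id \<in> M" "(\<lambda>x. x) \<in> M"
  by (simp_all add: in_iff)

lemma diff_in: "A \<in> M \<Longrightarrow> B \<in> M \<Longrightarrow> (\<lambda>x. A x - B x) \<in> M"
  by (simp add: in_iff bounded_op_diff commutant_linear)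

lemma scaleC_in: "A \<in> M \<Longrightarrow> (\<lambda>x. c *\<^sub>C A x) \<in> M"
  by (simp add: in_iff bounded_op_scaleC commutant_linear)

lemma comp_in: "A \<in> M \<Longrightarrow> B \<in> M \<Longrightarrow> A \<circ> B \<in> M"
  by (simp add: in_iff bounded_op_comp)

lemma funpow_in: "A \<in> M \<Longrightarrow> A ^^ n \<in> M"
  by (induction n) (auto intro: comp_in id_in)

text \<open>Invariance under the unitaries of the commutant makes intersections immediate and
  matches the condition in \<open>affiliated_ops\<close>. For the converse, the adjoint of such a
  unitary is another one, so the orthogonal complement is invariant too and the projection commutes
  with the unitary.\<close>

lemma aff_subspace_iff:
  "aff_subspace M S \<longleftrightarrow>
     closed_csubspace S \<and> (\<forall>U\<in>commutant M. is_unitary U \<longrightarrow> (\<forall>x\<in>S. U x \<in> S))"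
proof (intro iffI conjI ballI impI)
  assume S: "aff_subspace M S"
  then show cl: "closed_csubspace S" by (simp add: aff_subspace_def)
  fix U x assume "U \<in> commutant M" "x \<in> S"
  then have "proj S (U x) = U x"
    using S proj_basic(4)[OF cl] by (simp add: aff_subspace_def in_iff)
  then show "U x \<in> S" using proj_basic(4)[OF cl] by simp
next
  assume *: "closed_csubspace S \<and> (\<forall>U\<in>commutant M. is_unitary U \<longrightarrow> (\<forall>x\<in>S. U x \<in> S))"
  then have cl: "closed_csubspace S" by blast
  have "proj S \<in> M"
  proof (rule in_von_neumann_algebra_if_commutes_with_unitaries[OF von_neumann proj_basic(1)[OF cl]])
    fix U assume U: "U \<in> commutant M" "is_unitary U"
    then obtain V where V: "V \<in> commutant M" "is_unitary V" "is_adjoint U V"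
      using unitary_commutant_inverse[OF star_closed U] by metis
    have "proj S (U x) = U (proj S x)" for x
    proof (rule proj_eqI[OF cl])
      show "U (proj S x) \<in> S" using * U proj_basic(6)[OF cl] by blast
      have "cinner (U (x - proj S x)) s = 0" if "s \<in> S" for s
        using is_adjointD[OF V(3)] V * that proj_basic(5)[OF cl, of x] by (simp add: orth_compl_def)
      then show "U x - U (proj S x) \<in> orth_compl S"
        by (simp add: orth_compl_def commutant_linear[OF U(1)])
    qed
    then show "U \<circ> proj S = proj S \<circ> U" by auto
  qed
  with cl show "aff_subspace M S" by (simp add: aff_subspace_def)
qed

lemma aff_closed [intro]: "aff_subspace M S \<Longrightarrow> closed_csubspace S"
  by (simp add: aff_subspace_def)

lemma aff_proj_in: "aff_subspace M S \<Longrightarrow> proj S \<in> M"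
  by (simp add: aff_subspace_def)

lemma aff_subspace_UNIV: "aff_subspace M UNIV" and aff_subspace_zero: "aff_subspace M {0}"
  by (simp_all add: aff_subspace_iff commutant_linear(4))

lemma aff_orth_compl: "aff_subspace M S \<Longrightarrow> aff_subspace M (orth_compl S)"
  by (simp add: aff_subspace_def proj_orth_compl diff_in id_in)

lemma aff_INT: "(\<And>i. i \<in> I \<Longrightarrow> aff_subspace M (S i)) \<Longrightarrow> aff_subspace M (\<Inter>i\<in>I. S i)"
  unfolding aff_subspace_iff by (auto intro: closed_csubspace_INT)

lemma aff_Int: "aff_subspace M S \<Longrightarrow> aff_subspace M T \<Longrightarrow> aff_subspace M (S \<inter> T)"
  unfolding aff_subspace_iff by (auto intro: closed_csubspace_Int)

lemma aff_closed_cspan_UN: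
  assumes "\<And>i. i \<in> I \<Longrightarrow> aff_subspace M (S i)"
  shows "aff_subspace M (closed_cspan (\<Union>i\<in>I. S i))"
  unfolding closed_cspan_eq_orth_compl orth_compl_UN
  by (intro aff_orth_compl aff_INT assms)

lemma aff_closed_cspan_Un:
  "aff_subspace M S \<Longrightarrow> aff_subspace M T \<Longrightarrow> aff_subspace M (closed_cspan (S \<union> T))"
  unfolding closed_cspan_eq_orth_compl orth_compl_Un
  by (intro aff_orth_compl aff_Int)

lemma aff_kernel:
  assumes A: "A \<in> M"
  shows "aff_subspace M {x. A x = 0}"
proof -
  note lin = bounded_op_linear[OF bounded[OF A]]
  have "closed {x. A x = 0}"
    by (intro closed_Collect_eq continuous_intros linear_continuous_on lin(1))
  then have "closed_csubspace {x. A x = 0}"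
    by (simp add: closed_csubspace_def complex_vector.subspace_def lin)
  then show ?thesis using A by (simp add: aff_subspace_iff in_iff commutant_linear(4))
qed

end

section \<open>The dimension function of a tracial state\<close>

locale tracial_vna = vna M for M :: "('a::complex_hilbert \<Rightarrow> 'a) set" +
  fixes \<tau> :: "('a \<Rightarrow> 'a) \<Rightarrow> complex"
  assumes state: "state_on M \<tau>" and tracial: "tracial_on M \<tau>"
    and faithful: "faithful_on M \<tau>" and normal: "normal_on M \<tau>"
begin

lemma tau_add: "A \<in> M \<Longrightarrow> B \<in> M \<Longrightarrow> \<tau> (\<lambda>x. A x + B x) = \<tau> A + \<tau> B"
  and tau_scaleC: "A \<in> M \<Longrightarrow> \<tau> (\<lambda>x. c *\<^sub>C A x) = c * \<tau> A"
  and tau_pos: "A \<in> M \<Longrightarrow> positive_op A \<Longrightarrow> \<tau> A \<in> \<real>\<^sub>\<ge>\<^sub>0"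
  and tau_id: "\<tau> id = 1" "\<tau> (\<lambda>x. x) = 1"
  and tau_comp: "A \<in> M \<Longrightarrow> B \<in> M \<Longrightarrow> \<tau> (A \<circ> B) = \<tau> (B \<circ> A)"
  using state tracial by (auto simp: state_on_def tracial_on_def id_def)

lemma tau_diff: "A \<in> M \<Longrightarrow> B \<in> M \<Longrightarrow> \<tau> (\<lambda>x. A x - B x) = \<tau> A - \<tau> B"
  using tau_add[of A "\<lambda>x. (-1) *\<^sub>C B x"] tau_scaleC[of B "-1"] scaleC_in[of B "-1"]
  by (simp add: scaleC.minus_left)

lemma tau_zero: "\<tau> (\<lambda>x. 0) = 0"
  using tau_diff[OF id_in(2) id_in(2)] by simp

lemma tau_op_le_mono:
  assumes "A \<in> M" "B \<in> M" "op_le A B"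
  shows "Re (\<tau> A) \<le> Re (\<tau> B)"
  using tau_pos[OF diff_in[OF assms(2,1)]] assms
  by (simp add: op_le_def tau_diff complex_nonneg_Reals_iff)

text \<open>A strong limit is only compared with upper bounds through quadratic forms, so it is the least
  upper bound required in the definition of normality.\<close>

lemma tau_increasing_tendsto:
  assumes A: "\<And>n. A n \<in> M" and B: "B \<in> M" and pos: "\<And>n. positive_op (A n)"
    and inc: "increases_to A B"
  shows "(\<lambda>n. Re (\<tau> (A n))) \<longlonglongrightarrow> Re (\<tau> B)"
proof -
  have lim: "(\<lambda>n. A n x) \<longlonglongrightarrow> B x" for x using inc by (simp add: increases_to_def)
  have add: "a + b \<in> \<real>\<^sub>\<ge>\<^sub>0" if "a \<in> \<real>\<^sub>\<ge>\<^sub>0" "b \<in> \<real>\<^sub>\<ge>\<^sub>0" for a b :: complex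
    using that by (rule nonneg_Reals_add_I)
  have form: "cinner (A n x - A m x) x \<in> \<real>\<^sub>\<ge>\<^sub>0" if "m \<le> n" for m n x
    using that
  proof (induction n rule: dec_induct)
    case (step n)
    have "cinner (A (Suc n) x - A n x) x \<in> \<real>\<^sub>\<ge>\<^sub>0"
      using inc by (simp add: increases_to_def op_le_def positive_op_def)
    from add[OF this step.IH] show ?case by (simp add: cinner.diff_left)
  qed (simp add: cinner.zero_left)
  have le: "op_le (A m) (A n)" if "m \<le> n" for m n
    using form[OF that] by (simp add: op_le_def positive_op_def bounded_op_diff bounded A)
  have upper: "op_le (A m) B" for m
    using form by (intro op_le_lim[OF bounded[OF A] bounded[OF B] lim] eventually_sequentiallyI[of m]) auto
  have least: "op_le B T" if T: "T \<in> M" and "\<forall>C\<in>range A. op_le C T" for T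
  proof -
    have "cinner (- A n x - - T x) x \<in> \<real>\<^sub>\<ge>\<^sub>0" for n x
      using that(2) by (simp add: op_le_def positive_op_def algebra_simps)
    \<comment> \<open>\<open>op_le_lim\<close> passes a lower bound to the limit; the upper bound
      \<open>T\<close> is made into one by negating all operators.\<close>
    then have "op_le (\<lambda>x. - T x) (\<lambda>x. - B x)"
      using bounded_op_diff[OF bounded_op_zero bounded[OF T]] bounded_op_diff[OF bounded_op_zero bounded[OF B]]
      by (intro op_le_lim[where X = "\<lambda>x n. - A n x"] tendsto_minus lim) auto
    then show ?thesis by (simp add: op_le_def)
  qed
  have "Re (\<tau> B) = (SUP C\<in>range A. Re (\<tau> C))"
  proof (rule normal[unfolded normal_on_def, rule_format], intro conjI ballI)
    fix C D assume "C \<in> range A" "D \<in> range A"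
    then obtain m n where "C = A m" "D = A n" by blast
    then show "\<exists>E\<in>range A. op_le C E \<and> op_le D E"
      using le[of m "max m n"] le[of n "max m n"] by auto
  qed (use A B pos upper least in auto)
  then have "Re (\<tau> B) = (SUP n. Re (\<tau> (A n)))" by (simp add: image_image)
  moreover have "bdd_above (range (\<lambda>n. Re (\<tau> (A n))))"
    using tau_op_le_mono[OF A B upper] by (auto simp: bdd_above_def)
  moreover have "incseq (\<lambda>n. Re (\<tau> (A n)))"
    using tau_op_le_mono[OF A A le] by (simp add: incseq_def)
  ultimately show ?thesis using LIMSEQ_incseq_SUP by metis
qed

section \<open>Dimension of subspaces\<close>

definition dim_tau :: "'a set \<Rightarrow> real" where
  "dim_tau S = Re (\<tau> (proj S))"

lemma tau_proj: "aff_subspace M S \<Longrightarrow> \<tau> (proj S) = complex_of_real (dim_tau S)"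
  using tau_pos[OF aff_proj_in positive_op_proj[OF aff_closed]]
  by (auto simp: dim_tau_def complex_nonneg_Reals_iff complex_eq_iff)

lemma dim_tau_zero: "dim_tau {0} = 0" and dim_tau_UNIV: "dim_tau UNIV = 1"
  by (simp_all add: dim_tau_def proj_zero proj_UNIV tau_zero tau_id)

lemma dim_tau_orth_compl: "aff_subspace M S \<Longrightarrow> dim_tau (orth_compl S) = 1 - dim_tau S"
  by (simp add: dim_tau_def proj_orth_compl aff_closed tau_diff[OF id_in(2) aff_proj_in] tau_id)

lemma dim_tau_mono:
  assumes "aff_subspace M S" "aff_subspace M T" "S \<subseteq> T"
  shows "dim_tau S \<le> dim_tau T"
  unfolding dim_tau_def
  using assms by (intro tau_op_le_mono aff_proj_in) (auto simp: op_le_proj_iff aff_closed)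

text \<open>Faithfulness applied to the positive difference of the two projections. This is the
  device by which dimension counts become equalities of subspaces.\<close>

lemma dim_tau_eq_imp_eq:
  assumes S: "aff_subspace M S" and T: "aff_subspace M T" and "S \<subseteq> T" "dim_tau T \<le> dim_tau S"
  shows "S = T"
proof -
  let ?A = "\<lambda>x. proj T x - proj S x"
  have "op_le (proj S) (proj T)" using assms by (simp add: op_le_proj_iff aff_closed)
  then have "positive_op ?A" by (simp add: op_le_def)
  moreover have "\<tau> ?A = 0"
    using dim_tau_mono[OF assms(1-3)] assms(4)
    by (simp add: tau_diff[OF aff_proj_in[OF T] aff_proj_in[OF S]] tau_proj[OF S] tau_proj[OF T])
  ultimately have "?A = (\<lambda>x. 0)"
    using faithful diff_in[OF aff_proj_in[OF T] aff_proj_in[OF S]] by (auto simp: faithful_on_def)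
  then have "proj T = proj S" by (auto simp: fun_eq_iff)
  then show ?thesis using range_proj[OF aff_closed] S T by metis
qed

lemma dim_tau_increasing_tendsto:
  assumes S: "\<And>n. aff_subspace M (S n)" and "incseq S"
  shows "(\<lambda>n. dim_tau (S n)) \<longlonglongrightarrow> dim_tau (closed_cspan (\<Union>n. S n))"
  unfolding dim_tau_def
proof (rule tau_increasing_tendsto)
  show "increases_to (\<lambda>n. proj (S n)) (proj (closed_cspan (\<Union>n. S n)))"
    using assms incseq_SucD[OF \<open>incseq S\<close>]
    by (auto simp: increases_to_def op_le_proj_iff aff_closed proj_increasing_tendsto)
qed (use S in \<open>auto intro!: aff_proj_in positive_op_proj aff_closed aff_closed_cspan_UN\<close>)

lemma dim_tau_decreasing_tendsto:
  assumes S: "\<And>n. aff_subspace M (S n)" and "decseq S"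
  shows "(\<lambda>n. dim_tau (S n)) \<longlonglongrightarrow> dim_tau (\<Inter>n. S n)"
proof -
  have "incseq (\<lambda>n. orth_compl (S n))"
    using \<open>decseq S\<close> unfolding incseq_def decseq_def by (intro allI impI orth_compl_antimono) simp
  with S have "(\<lambda>n. dim_tau (orth_compl (S n))) \<longlonglongrightarrow> dim_tau (closed_cspan (\<Union>n. orth_compl (S n)))"
    by (intro dim_tau_increasing_tendsto aff_orth_compl)
  moreover have "closed_cspan (\<Union>n. orth_compl (S n)) = orth_compl (\<Inter>n. S n)"
    using S by (subst orth_compl_INT) auto
  ultimately have "(\<lambda>n. 1 - dim_tau (S n)) \<longlonglongrightarrow> 1 - dim_tau (\<Inter>n. S n)"
    using S by (simp add: dim_tau_orth_compl aff_INT)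
  from tendsto_diff[OF tendsto_const[of 1] this] show ?thesis by simp
qed

text \<open>The powers of \<open>1 - T' T\<close> see only the kernel of \<open>T\<close> in the
  limit, so the dimension of that kernel can be read off from traces of polynomials in
  \<open>T' T\<close>.\<close>

lemma tau_powers_tendsto_dim_kernel:
  assumes T: "T \<in> M" "T' \<in> M" and adj: "is_adjoint T T'" and contr: "\<And>x. norm (T x) \<le> norm x"
  shows "(\<lambda>n. Re (\<tau> ((\<lambda>x. x - T' (T x)) ^^ (2 * n)))) \<longlonglongrightarrow> dim_tau {x. T x = 0}"
proof -
  define C where "C = (\<lambda>x. x - T' (T x))"
  note adj' = is_adjoint_sym[OF adj]
  have CM: "C \<in> M" unfolding C_def using diff_in[OF id_in(2) comp_in[OF T(2,1)]] by (simp add: comp_def)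
  have C_adj: "is_adjoint C C"
    by (simp add: is_adjoint_def C_def cinner.diff_left cinner.diff_right is_adjointD[OF adj] is_adjointD[OF adj'])
  \<comment> \<open>This one estimate shows both that \<open>C\<close> is a contraction and that
    \<open>T\<close> kills every fixed point of \<open>C\<close> applied twice.\<close>
  have C_norm: "(norm (C x))\<^sup>2 \<le> (norm x)\<^sup>2 - (norm (T x))\<^sup>2" for x
  proof -
    have "cinner x (T' (T x)) = cinner (T x) (T x)" by (simp add: is_adjointD[OF adj])
    then have "(norm (C x))\<^sup>2 = (norm x)\<^sup>2 + (norm (T' (T x)))\<^sup>2 - 2 * (norm (T x))\<^sup>2"
      by (simp add: C_def norm_diff_square cinner_self del: of_real_power)
    moreover have "norm (T' (T x)) \<le> norm (T x)" by (rule contraction_adjoint[OF adj contr])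
    then have "(norm (T' (T x)))\<^sup>2 \<le> (norm (T x))\<^sup>2" by (simp add: power_mono)
    ultimately show ?thesis by simp
  qed
  have "(norm (C x))\<^sup>2 \<le> (norm x)\<^sup>2" for x using C_norm[of x] by (smt (verit) zero_le_power2)
  then have C_contr: "norm (C x) \<le> norm x" for x by (rule power2_le_imp_le) simp
  have ker: "{x. C (C x) = x} = {x. T x = 0}"
  proof (intro set_eqI iffI CollectI; elim CollectE)
    fix x assume "C (C x) = x"
    then have "norm x \<le> norm (C x)" using C_contr[of "C x"] by simp
    then have "(norm x)\<^sup>2 \<le> (norm (C x))\<^sup>2" by (simp add: power_mono)
    with C_norm[of x] have "(norm (T x))\<^sup>2 \<le> 0" by linarith
    then show "T x = 0" by simp
  next
    fix x assume "T x = 0"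
    then have "C x = x" using bounded_op_linear(5)[OF bounded[OF T(2)]] by (simp add: C_def)
    then show "C (C x) = x" by simp
  qed
  let ?K = "{x. T x = 0}"
  have K: "aff_subspace M ?K" by (rule aff_kernel[OF T(1)])
  note pow_adj = selfadjoint_funpow[OF C_adj]
  have form: "cinner ((C ^^ (2 * n)) x) x = complex_of_real ((norm ((C ^^ n) x))\<^sup>2)" for n x
    unfolding cinner_self[symmetric] by (simp add: mult_2 funpow_add pow_adj)
  have pow_le: "norm ((C ^^ n) x) \<le> norm x" for n x
    by (induction n) (auto intro: order_trans[OF C_contr])
  \<comment> \<open>Normality concerns increasing families of positive elements, so it is applied to
    the complements of the decreasing powers.\<close>
  have "(\<lambda>n. Re (\<tau> (\<lambda>x. x - (C ^^ (2 * n)) x))) \<longlonglongrightarrow> Re (\<tau> (\<lambda>x. x - proj ?K x))"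
  proof (rule tau_increasing_tendsto)
    show "positive_op (\<lambda>x. x - (C ^^ (2 * n)) x)" for n
    proof -
      have "(norm ((C ^^ n) x))\<^sup>2 \<le> (norm x)\<^sup>2" for x by (simp add: pow_le power_mono)
      then show ?thesis
        by (simp add: positive_op_def bounded_op_diff bounded_op_funpow bounded[OF CM] cinner.diff_left
            form cinner_self complex_nonneg_Reals_iff del: of_real_power)
    qed
    show "increases_to (\<lambda>n x. x - (C ^^ (2 * n)) x) (\<lambda>x. x - proj ?K x)"
      unfolding increases_to_def
    proof (intro conjI allI)
      fix n
      have "(norm ((C ^^ Suc n) x))\<^sup>2 \<le> (norm ((C ^^ n) x))\<^sup>2" for x by (simp add: C_contr power_mono)
      then have "cinner ((x - (C ^^ (2 * Suc n)) x) - (x - (C ^^ (2 * n)) x)) x \<in> \<real>\<^sub>\<ge>\<^sub>0" for x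
        unfolding cinner.diff_left form by (simp add: complex_nonneg_Reals_iff del: of_real_power)
      then show "op_le (\<lambda>x. x - (C ^^ (2 * n)) x) (\<lambda>x. x - (C ^^ (2 * Suc n)) x)"
        unfolding op_le_def positive_op_def
        by (intro conjI allI bounded_op_diff bounded_op_funpow bounded[OF CM] bounded_op_id)
    next
      fix x
      show "(\<lambda>n. x - (C ^^ (2 * n)) x) \<longlonglongrightarrow> x - proj ?K x"
        using selfadjoint_contraction_powers_tendsto(2)[OF bounded[OF CM] C_adj C_contr, of x]
        unfolding ker by (intro tendsto_diff tendsto_const)
    qed
  qed (intro diff_in[OF id_in(2)] funpow_in[OF CM] aff_proj_in[OF K])+
  then have "(\<lambda>n. 1 - Re (\<tau> (C ^^ (2 * n)))) \<longlonglongrightarrow> 1 - dim_tau ?K"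
    by (simp add: tau_diff[OF id_in(2) funpow_in[OF CM]] tau_diff[OF id_in(2) aff_proj_in[OF K]] tau_id dim_tau_def)
  from tendsto_diff[OF tendsto_const[of 1] this] show ?thesis by (simp add: C_def)
qed

text \<open>\<open>T\<close> intertwines the two operators: \<open>T C = D T\<close>. Cyclicity of
  the trace therefore turns \<open>C^n T' T\<close> into \<open>D^n T T'\<close>, which is exactly
  what separates consecutive powers on either side. The result stands in for the equivalence of the
  left and right supports of \<open>T\<close>.\<close>

lemma dim_tau_kernel_adjoint:
  assumes T: "T \<in> M" "T' \<in> M" and adj: "is_adjoint T T'" and contr: "\<And>x. norm (T x) \<le> norm x"
  shows "dim_tau {x. T x = 0} = dim_tau {x. T' x = 0}"
proof -
  define C where "C = (\<lambda>x. x - T' (T x))"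
  define D where "D = (\<lambda>x. x - T (T' x))"
  have CM: "C \<in> M" unfolding C_def using diff_in[OF id_in(2) comp_in[OF T(2,1)]] by (simp add: comp_def)
  have DM: "D \<in> M" unfolding D_def using diff_in[OF id_in(2) comp_in[OF T]] by (simp add: comp_def)
  note T_lin = bounded_op_linear[OF bounded[OF T(1)]]
  have TC: "T ((C ^^ n) x) = (D ^^ n) (T x)" for n x
    by (induction n arbitrary: x) (simp_all add: C_def D_def T_lin)
  have "\<tau> (C ^^ n) = \<tau> (D ^^ n)" for n
  proof (induction n)
    case (Suc n)
    have "C ^^ Suc n = (\<lambda>x. (C ^^ n) x - ((C ^^ n) \<circ> T' \<circ> T) x)"
      using bounded_op_linear(4)[OF bounded_op_funpow[OF bounded[OF CM]]]
      by (simp add: fun_eq_iff funpow_swap1) (simp add: C_def)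
    then have "\<tau> (C ^^ Suc n) = \<tau> (C ^^ n) - \<tau> ((C ^^ n) \<circ> T' \<circ> T)"
      by (simp only: tau_diff[OF funpow_in comp_in[OF comp_in[OF funpow_in T(2)] T(1)]] CM)
    also have "\<tau> ((C ^^ n) \<circ> T' \<circ> T) = \<tau> (T \<circ> ((C ^^ n) \<circ> T'))"
      by (rule tau_comp[OF comp_in[OF funpow_in[OF CM] T(2)] T(1)])
    also have "T \<circ> ((C ^^ n) \<circ> T') = (D ^^ n) \<circ> (T \<circ> T')" by (simp add: fun_eq_iff TC)
    also have "\<tau> (C ^^ n) - \<tau> ((D ^^ n) \<circ> (T \<circ> T')) = \<tau> (\<lambda>x. (D ^^ n) x - ((D ^^ n) \<circ> (T \<circ> T')) x)"
      by (simp only: tau_diff[OF funpow_in comp_in[OF funpow_in comp_in[OF T]]] DM Suc.IH)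
    also have "(\<lambda>x. (D ^^ n) x - ((D ^^ n) \<circ> (T \<circ> T')) x) = D ^^ Suc n"
      using bounded_op_linear(4)[OF bounded_op_funpow[OF bounded[OF DM]]]
      by (simp add: fun_eq_iff funpow_swap1) (simp add: D_def)
    finally show ?case .
  qed simp
  moreover have "(\<lambda>n. Re (\<tau> (C ^^ (2 * n)))) \<longlonglongrightarrow> dim_tau {x. T x = 0}"
    unfolding C_def by (rule tau_powers_tendsto_dim_kernel[OF T adj contr])
  moreover have "(\<lambda>n. Re (\<tau> (D ^^ (2 * n)))) \<longlonglongrightarrow> dim_tau {x. T' x = 0}"
    unfolding D_def
    by (rule tau_powers_tendsto_dim_kernel[OF T(2,1) is_adjoint_sym[OF adj] contraction_adjoint[OF adj contr]])
  ultimately show ?thesis using LIMSEQ_unique by simp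
qed

text \<open>A vector is killed by \<open>(1 - q) p\<close> when \<open>p\<close> sends it into
  \<open>Q\<close>. The kernel is thus the orthogonal sum of \<open>orth_compl P\<close> and
  \<open>P \<inter> Q\<close>, and its projection is \<open>1 - p\<close> plus the projection onto
  the intersection.\<close>

lemma dim_tau_kernel_proj_proj:
  assumes P: "aff_subspace M P" and Q: "aff_subspace M Q"
  shows "dim_tau {x. proj P x - proj Q (proj P x) = 0} = 1 - dim_tau P + dim_tau (P \<inter> Q)"
proof -
  let ?K = "{x. proj P x - proj Q (proj P x) = 0}"
  note p = proj_basic[OF aff_closed[OF P]] and q = proj_basic[OF aff_closed[OF Q]]
  have PQ: "aff_subspace M (P \<inter> Q)" by (rule aff_Int[OF P Q])
  note g = proj_basic[OF aff_closed[OF PQ]]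
  have "aff_subspace M ?K"
    using diff_in[OF aff_proj_in[OF P] comp_in[OF aff_proj_in[OF Q] aff_proj_in[OF P]]]
    by (intro aff_kernel) (simp add: comp_def)
  then have K: "closed_csubspace ?K" by (rule aff_closed)
  have in_K: "x \<in> ?K \<longleftrightarrow> proj P x \<in> Q" for x using q(4)[of "proj P x"] by auto
  have "proj ?K x = (x - proj P x) + proj (P \<inter> Q) x" for x
  proof (rule proj_eqI[OF K])
    have "proj P ((x - proj P x) + proj (P \<inter> Q) x) = proj (P \<inter> Q) x"
      using g(6)[of x] p(4) by (simp add: bounded_op_linear[OF p(1)] p(2))
    then show "(x - proj P x) + proj (P \<inter> Q) x \<in> ?K" unfolding in_K using g(6)[of x] by simp
    have eq: "cinner (proj P x) k = cinner (proj (P \<inter> Q) x) k" if "k \<in> ?K" for k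
    proof -
      have "proj P k \<in> P \<inter> Q" using that p(6) unfolding in_K by blast
      then have "cinner x (proj P k) = cinner (proj (P \<inter> Q) x) (proj P k)" using g(3,4) by metis
      also have "\<dots> = cinner (proj (P \<inter> Q) x) k" using g(6)[of x] p(3,4) by (metis IntD1)
      finally show ?thesis by (simp add: p(3))
    qed
    show "x - ((x - proj P x) + proj (P \<inter> Q) x) \<in> orth_compl ?K"
      unfolding orth_compl_def by (intro CollectI ballI) (simp add: cinner.diff_left eq)
  qed
  then have "proj ?K = (\<lambda>x. (x - proj P x) + proj (P \<inter> Q) x)" by blast
  then have "\<tau> (proj ?K) = (1 - \<tau> (proj P)) + \<tau> (proj (P \<inter> Q))"
    using tau_add[OF diff_in[OF id_in(2) aff_proj_in[OF P]] aff_proj_in[OF PQ]]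
      tau_diff[OF id_in(2) aff_proj_in[OF P]] by (simp add: tau_id)
  then show ?thesis by (simp add: dim_tau_def)
qed

text \<open>For the operators \<open>T = (1 - q) p\<close> and \<open>T\<^sup>* = p (1 - q)\<close> the equality of the
  dimensions of the kernels is the parallelogram law.\<close>

lemma dim_tau_modular:
  assumes P: "aff_subspace M P" and Q: "aff_subspace M Q"
  shows "dim_tau (closed_cspan (P \<union> Q)) + dim_tau (P \<inter> Q) = dim_tau P + dim_tau Q"
proof -
  note p = proj_basic[OF aff_closed[OF P]] and q = proj_basic[OF aff_closed[OF Q]]
  let ?T = "\<lambda>x. proj P x - proj Q (proj P x)" and ?T' = "\<lambda>x. proj P (x - proj Q x)"
  have P': "aff_subspace M (orth_compl P)" and Q': "aff_subspace M (orth_compl Q)"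
    by (intro aff_orth_compl P Q)+
  have T: "?T \<in> M"
    using diff_in[OF aff_proj_in[OF P] comp_in[OF aff_proj_in[OF Q] aff_proj_in[OF P]]] by (simp add: comp_def)
  have T': "?T' \<in> M"
    using comp_in[OF aff_proj_in[OF P] diff_in[OF id_in(2) aff_proj_in[OF Q]]] by (simp add: comp_def)
  have "is_adjoint ?T ?T'"
    unfolding is_adjoint_def by (simp add: cinner.diff_left cinner.diff_right p(3) q(3) bounded_op_linear[OF p(1)])
  moreover have "norm (?T x) \<le> norm x" for x
  proof -
    have "norm (?T x) \<le> norm (proj P x)"
      using norm_proj_le[OF aff_closed[OF Q'], of "proj P x"] by (simp add: proj_orth_compl[OF aff_closed[OF Q]])
    also have "\<dots> \<le> norm x" by (rule norm_proj_le[OF aff_closed[OF P]])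
    finally show ?thesis .
  qed
  ultimately have "dim_tau {x. ?T x = 0} = dim_tau {x. ?T' x = 0}"
    by (rule dim_tau_kernel_adjoint[OF T T'])
  \<comment> \<open>The adjoint has the same shape for the complements: \<open>p (1 - q)\<close>
    equals \<open>(1 - p') q'\<close> with \<open>p' = 1 - p\<close> and \<open>q' = 1 - q\<close>.
    So the kernel formula applies a second time.\<close>
  moreover have "?T' x = proj (orth_compl Q) x - proj (orth_compl P) (proj (orth_compl Q) x)" for x
    by (simp add: proj_orth_compl aff_closed[OF P] aff_closed[OF Q])
  ultimately have "1 - dim_tau P + dim_tau (P \<inter> Q)
      = 1 - dim_tau (orth_compl Q) + dim_tau (orth_compl Q \<inter> orth_compl P)"
    using dim_tau_kernel_proj_proj[OF P Q] dim_tau_kernel_proj_proj[OF Q' P'] by simp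
  moreover have "orth_compl Q \<inter> orth_compl P = orth_compl (closed_cspan (P \<union> Q))"
    by (auto simp: orth_compl_closed_cspan orth_compl_Un)
  ultimately show ?thesis
    by (simp add: dim_tau_orth_compl Q aff_closed_cspan_Un[OF P Q])
qed

end

section \<open>Idempotents as oblique projections\<close>

text \<open>The graph of the projection onto \<open>R\<close> along \<open>K\<close>, with
  \<open>y\<close> and \<open>x - y\<close> the two components of \<open>x\<close>. For closed
  subspaces both conditions are closed, so the graph is closed even when its domain, the algebraic
  sum of \<open>R\<close> and \<open>K\<close>, is not.\<close>

definition oblique :: "'a::complex_hilbert set \<Rightarrow> 'a set \<Rightarrow> 'a unbounded_op" where
  "oblique R K = {(x, y). y \<in> R \<and> x - y \<in> K}"

lemma in_oblique_iff: "(x, y) \<in> oblique R K \<longleftrightarrow> y \<in> R \<and> x - y \<in> K"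
  by (simp add: oblique_def)

lemma closed_oblique:
  assumes "closed_csubspace R" "closed_csubspace K"
  shows "closed (oblique R K)"
proof -
  have "oblique R K = (snd -` R) \<inter> ((\<lambda>p. fst p - snd p) -` K)" by (auto simp: oblique_def)
  then show ?thesis using assms
    by (simp add: closed_Int closed_vimage closed_csubspaceD(1) continuous_on_fst continuous_on_snd
        continuous_on_diff continuous_on_id)
qed

lemma linear_operator_oblique:
  assumes R: "closed_csubspace R" and K: "closed_csubspace K" and "R \<inter> K = {0}"
  shows "linear_operator (oblique R K)"
proof -
  have "y = z" if "y \<in> R" "x - y \<in> K" "z \<in> R" "x - z \<in> K" for x y z
  proof -
    have "y - z \<in> R \<inter> K"
      using closed_csubspaceD(5)[OF R that(1,3)] closed_csubspaceD(5)[OF K that(4,2)] by simp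
    then show ?thesis using assms(3) by simp
  qed
  moreover have "(x + x') - (y + y') \<in> K" if "x - y \<in> K" "x' - y' \<in> K" for x x' y y'
    using closed_csubspaceD(3)[OF K that] by (simp add: add_diff_add)
  moreover have "c *\<^sub>C x - c *\<^sub>C y \<in> K" if "x - y \<in> K" for c x y
    using closed_csubspaceD(4)[OF K that, of c] by (simp add: scaleC.diff_right)
  ultimately show ?thesis
    unfolding linear_operator_def single_valued_def in_oblique_iff
    using closed_csubspaceD(2-4)[OF R] closed_csubspaceD(2)[OF K] by (simp, blast)
qed

lemma Domain_oblique:
  assumes "closed_csubspace R" "closed_csubspace K"
  shows "Domain (oblique R K) = complex_vector.span (R \<union> K)"
proof -
  have "complex_vector.span R = R" "complex_vector.span K = K"
    using assms by (simp_all add: closed_csubspace_def complex_vector.span_eq_iff)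
  then have "complex_vector.span (R \<union> K) = {r + k | r k. r \<in> R \<and> k \<in> K}"
    by (simp only: complex_vector.span_Un)
  moreover have "Domain (oblique R K) = {r + k | r k. r \<in> R \<and> k \<in> K}"
    unfolding oblique_def by force
  ultimately show ?thesis by simp
qed

lemma closure_Domain_oblique:
  "closed_csubspace R \<Longrightarrow> closed_csubspace K \<Longrightarrow> closure (Domain (oblique R K)) = closed_cspan (R \<union> K)"
  by (simp add: Domain_oblique closed_cspan_def)

text \<open>Only the sums converge; \<open>a\<close> and \<open>b\<close> separately may diverge,
  since the algebraic sum of \<open>A\<close> and \<open>B\<close> need not be closed. Later
  approximations are arranged so that only the sums occur in the limit.\<close>

lemma closed_cspan_Un_sequential:
  assumes A: "closed_csubspace A" and B: "closed_csubspace B" and w: "w \<in> closed_cspan (A \<union> B)"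
  obtains a b where "\<And>n. a n \<in> A" "\<And>n. b n \<in> B" "(\<lambda>n. a n + b n) \<longlonglongrightarrow> w"
proof -
  have "w \<in> closure (Domain (oblique A B))" using w closure_Domain_oblique[OF A B] by simp
  then obtain f where f: "\<And>n. f n \<in> Domain (oblique A B)" "f \<longlonglongrightarrow> w"
    unfolding closure_sequential by blast
  then have "\<exists>a. a \<in> A \<and> f n - a \<in> B" for n
    unfolding Domain_iff in_oblique_iff by simp
  then obtain a where "\<And>n. a n \<in> A" "\<And>n. f n - a n \<in> B" by metis
  then show thesis using that[of a "\<lambda>n. f n - a n"] f(2) by simp
qed

lemma Range_oblique: "closed_csubspace K \<Longrightarrow> Range (oblique R K) = R"
proof (intro set_eqI iffI)
  fix y assume "closed_csubspace K" "y \<in> R"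
  then have "(y, y) \<in> oblique R K" by (simp add: in_oblique_iff closed_csubspaceD(2))
  then show "y \<in> Range (oblique R K)" by blast
qed (auto simp: oblique_def)

lemma op_kernel_oblique: "closed_csubspace R \<Longrightarrow> op_kernel (oblique R K) = K"
  by (simp add: op_kernel_def in_oblique_iff closed_csubspaceD(2))

lemma supp_oblique: "closed_csubspace R \<Longrightarrow> supp (oblique R K) = proj (orth_compl K)"
  by (simp add: supp_def op_kernel_oblique proj_def)

lemma in_aff_zero_iff: "(x, y) \<in> aff_zero \<longleftrightarrow> y = 0"
  by (auto simp: aff_zero_def graph_of_def)

lemma oblique_zero_UNIV: "oblique {0} UNIV = aff_zero"
  by (auto simp: oblique_def in_aff_zero_iff)

lemma aff_times_oblique_self:
  assumes R: "closed_csubspace R" and K: "closed_csubspace K" and "R \<inter> K = {0}"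
  shows "aff_times (oblique R K) (oblique R K) = oblique R K"
proof -
  have "op_times (oblique R K) (oblique R K) = oblique R K"
  proof (intro set_eqI iffI; clarify)
    fix x z assume "(x, z) \<in> op_times (oblique R K) (oblique R K)"
    then obtain y where y: "y \<in> R" "x - y \<in> K" "z \<in> R" "y - z \<in> K"
      by (auto simp: op_times_def in_oblique_iff)
    then have "y - z \<in> R \<inter> K" using closed_csubspaceD(5)[OF R y(1,3)] by simp
    then have "y = z" using assms(3) by simp
    then show "(x, z) \<in> oblique R K" using y by (simp add: in_oblique_iff)
  next
    fix x z assume "(x, z) \<in> oblique R K"
    moreover then have "(z, z) \<in> oblique R K" using closed_csubspaceD(2)[OF K] by (simp add: in_oblique_iff)
    ultimately show "(x, z) \<in> op_times (oblique R K) (oblique R K)" by (auto simp: op_times_def)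
  qed
  then show ?thesis using closed_oblique[OF R K] by (simp add: aff_times_def)
qed

lemma limit_in_closure:
  fixes f :: "nat \<Rightarrow> 'a::first_countable_topology"
  assumes "f \<longlonglongrightarrow> l" "\<And>n. f n \<in> A"
  shows "l \<in> closure A"
proof (rule closed_sequentially[OF closed_closure])
  show "f n \<in> closure A" for n using assms(2) closure_subset by blast
qed (fact assms(1))

text \<open>The inclusions \<open>sub\<close> express that the idempotents annihilate each other.
  The algebraic sum satisfies the conditions on the right, which are closed. Conversely, a value
  \<open>w\<close> in the closed span is approximated by sums \<open>a n + b n\<close> while the
  kernel component \<open>x - w\<close> stays fixed; by \<open>sub\<close> these approximants lie in
  the algebraic sum.\<close>

lemma aff_plus_oblique:
  assumes R1: "closed_csubspace R1" and K1: "closed_csubspace K1"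
    and R2: "closed_csubspace R2" and K2: "closed_csubspace K2"
    and sub: "R1 \<subseteq> K2" "R2 \<subseteq> K1"
  shows "aff_plus (oblique R1 K1) (oblique R2 K2) = oblique (closed_cspan (R1 \<union> R2)) (K1 \<inter> K2)"
proof
  let ?J = "closed_cspan (R1 \<union> R2)" and ?P = "op_plus (oblique R1 K1) (oblique R2 K2)"
  have J: "R1 \<subseteq> ?J" "R2 \<subseteq> ?J" using closed_cspan_superset[of "R1 \<union> R2"] by auto
  have "?P \<subseteq> oblique ?J (K1 \<inter> K2)"
  proof clarify
    fix x w assume "(x, w) \<in> ?P"
    then obtain y z where yz: "w = y + z" "y \<in> R1" "x - y \<in> K1" "z \<in> R2" "x - z \<in> K2"
      by (auto simp: op_plus_def in_oblique_iff)
    have "(x - y) - z \<in> K1" using closed_csubspaceD(5)[OF K1 yz(3)] yz(4) sub by blast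
    moreover have "(x - z) - y \<in> K2" using closed_csubspaceD(5)[OF K2 yz(5)] yz(2) sub by blast
    moreover have "y + z \<in> ?J" using closed_csubspaceD(3)[OF closed_csubspace_closed_cspan] yz J by blast
    ultimately show "(x, w) \<in> oblique ?J (K1 \<inter> K2)"
      using yz(1) by (simp add: in_oblique_iff algebra_simps)
  qed
  then show "aff_plus (oblique R1 K1) (oblique R2 K2) \<subseteq> oblique ?J (K1 \<inter> K2)"
    unfolding aff_plus_def
    by (intro closure_minimal closed_oblique closed_csubspace_Int K1 K2 closed_csubspace_closed_cspan)
  show "oblique ?J (K1 \<inter> K2) \<subseteq> aff_plus (oblique R1 K1) (oblique R2 K2)"
  proof clarify
    fix x w assume "(x, w) \<in> oblique ?J (K1 \<inter> K2)"
    then have w: "w \<in> ?J" and k: "x - w \<in> K1" "x - w \<in> K2" by (auto simp: in_oblique_iff)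
    obtain a b where a: "\<And>n. a n \<in> R1" and b: "\<And>n. b n \<in> R2" and lim: "(\<lambda>n. a n + b n) \<longlonglongrightarrow> w"
      using closed_cspan_Un_sequential[OF R1 R2 w] by metis
    have "(\<lambda>n. (a n + b n) + (x - w)) \<longlonglongrightarrow> w + (x - w)" by (intro tendsto_add lim tendsto_const)
    then have "(\<lambda>n. ((a n + b n) + (x - w), a n + b n)) \<longlonglongrightarrow> (x, w)"
      using lim by (simp add: tendsto_Pair)
    moreover have "((a n + b n) + (x - w), a n + b n) \<in> ?P" for n
    proof -
      have "b n + (x - w) \<in> K1" "a n + (x - w) \<in> K2"
        using a[of n] b[of n] k sub closed_csubspaceD(3)[OF K1] closed_csubspaceD(3)[OF K2] by blast+
      then have "((a n + b n) + (x - w), a n) \<in> oblique R1 K1" "((a n + b n) + (x - w), b n) \<in> oblique R2 K2"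
        using a b by (simp_all add: in_oblique_iff algebra_simps)
      then show ?thesis unfolding op_plus_def by blast
    qed
    ultimately show "(x, w) \<in> aff_plus (oblique R1 K1) (oblique R2 K2)"
      unfolding aff_plus_def by (rule limit_in_closure)
  qed
qed

lemma in_op_uminus_iff: "(x, y) \<in> op_uminus T \<longleftrightarrow> (x, - y) \<in> T"
proof
  assume "(x, - y) \<in> T"
  then have "(x, - (- y)) \<in> op_uminus T" unfolding op_uminus_def by blast
  then show "(x, y) \<in> op_uminus T" by simp
qed (auto simp: op_uminus_def)

lemma in_op_times_graph_of_iff:
  "(x, z) \<in> op_times (graph_of A) T \<longleftrightarrow> (\<exists>y. (x, y) \<in> T \<and> z = A y)"
  "(x, z) \<in> op_times T (graph_of A) \<longleftrightarrow> (A x, z) \<in> T"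
  by (auto simp: op_times_def graph_of_def)

lemma closed_op_uminus:
  assumes "closed T"
  shows "closed (op_uminus T)"
proof -
  have "op_uminus T = (\<lambda>p. (fst p, - snd p)) -` T" by (auto simp: in_op_uminus_iff)
  then show ?thesis using assms by (auto intro!: closed_vimage continuous_intros)
qed

text \<open>Meant for the case in which \<open>oblique R K\<close> is the sum of the other two, so
  that subtracting it leaves minus the second. The hypotheses \<open>sub\<close> are inclusions of
  the expected kind; those in \<open>eq\<close> rest on counting and come from
  \<open>complementary_sum\<close>. The first of \<open>eq\<close> puts the difference into the
  range \<open>R2\<close>, the second makes the algebraic difference dense: the value
  \<open>w\<close> is kept fixed and only the kernel component \<open>x + w\<close> is
  approximated.\<close>

lemma aff_minus_oblique:
  assumes R1: "closed_csubspace R1" and K1: "closed_csubspace K1"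
    and R2: "closed_csubspace R2" and K2: "closed_csubspace K2"
    and R: "closed_csubspace R" and K: "closed_csubspace K"
    and sub: "R1 \<subseteq> K2" "R2 \<subseteq> K1" "R1 \<subseteq> R" "R2 \<subseteq> R" "K \<subseteq> K1" "K \<subseteq> K2"
    and eq: "R \<inter> K1 \<subseteq> R2" "K2 \<subseteq> closed_cspan (R1 \<union> K)"
  shows "aff_minus (oblique R1 K1) (oblique R K) = op_uminus (oblique R2 K2)"
proof
  let ?P = "op_plus (oblique R1 K1) (op_uminus (oblique R K))"
  have "?P \<subseteq> op_uminus (oblique R2 K2)"
  proof clarify
    fix x w assume "(x, w) \<in> ?P"
    then obtain s t where w: "w = s + t" and s: "s \<in> R1" "x - s \<in> K1" and t: "- t \<in> R" "x - - t \<in> K"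
      unfolding op_plus_def by (auto simp: in_oblique_iff in_op_uminus_iff)
    define r where "r = - t"
    have r: "r \<in> R" "x - r \<in> K" and w: "w = s - r" using t w by (simp_all add: r_def)
    have "r - s \<in> R" using closed_csubspaceD(5)[OF R r(1)] s(1) sub by blast
    moreover have "(x - s) - (x - r) \<in> K1" using closed_csubspaceD(5)[OF K1 s(2)] r(2) sub by blast
    ultimately have "r - s \<in> R2" using eq by auto
    moreover have "(x - r) + s \<in> K2" using closed_csubspaceD(3)[OF K2] r(2) s(1) sub by blast
    ultimately show "(x, w) \<in> op_uminus (oblique R2 K2)"
      unfolding w in_op_uminus_iff in_oblique_iff by (simp add: algebra_simps)
  qed
  then show "aff_minus (oblique R1 K1) (oblique R K) \<subseteq> op_uminus (oblique R2 K2)"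
    unfolding aff_minus_def aff_plus_def
    by (intro closure_minimal closed_op_uminus closed_oblique R2 K2)
  show "op_uminus (oblique R2 K2) \<subseteq> aff_minus (oblique R1 K1) (oblique R K)"
  proof clarify
    fix x w assume "(x, w) \<in> op_uminus (oblique R2 K2)"
    then have w: "- w \<in> R2" "x + w \<in> K2" by (auto simp: in_op_uminus_iff in_oblique_iff)
    then have "x + w \<in> closed_cspan (R1 \<union> K)" using eq by blast
    then obtain a b where a: "\<And>n. a n \<in> R1" and b: "\<And>n. b n \<in> K" and lim: "(\<lambda>n. a n + b n) \<longlonglongrightarrow> x + w"
      using closed_cspan_Un_sequential[OF R1 K, of "x + w"] by metis
    have "(\<lambda>n. (a n + b n) - w) \<longlonglongrightarrow> (x + w) - w" by (intro tendsto_diff lim tendsto_const)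
    then have "(\<lambda>n. ((a n + b n) - w, w)) \<longlonglongrightarrow> (x, w)"
      by (simp add: tendsto_Pair)
    moreover have "((a n + b n) - w, w) \<in> ?P" for n
    proof -
      have "b n + - w \<in> K1" "a n + - w \<in> R"
        using a[of n] b[of n] w sub closed_csubspaceD(3)[OF K1] closed_csubspaceD(3)[OF R] by blast+
      then have "((a n + b n) - w, a n) \<in> oblique R1 K1"
          "((a n + b n) - w, - (a n + - w)) \<in> op_uminus (oblique R K)"
        using a b by (simp_all add: in_oblique_iff in_op_uminus_iff algebra_simps)
      moreover have "w = a n + - (a n + - w)" by simp
      ultimately show ?thesis unfolding op_plus_def by blast
    qed
    ultimately show "(x, w) \<in> aff_minus (oblique R1 K1) (oblique R K)"
      unfolding aff_minus_def aff_plus_def by (rule limit_in_closure)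
  qed
qed

section \<open>Affiliated idempotents and complementary pairs\<close>

context vna
begin

definition complementary :: "'a set \<Rightarrow> 'a set \<Rightarrow> bool" where
  "complementary R K \<longleftrightarrow> aff_subspace M R \<and> aff_subspace M K \<and> R \<inter> K = {0} \<and>
     closed_cspan (R \<union> K) = UNIV"

lemma complementaryD:
  assumes "complementary R K"
  shows "aff_subspace M R" "aff_subspace M K" "R \<inter> K = {0}" "closed_cspan (R \<union> K) = UNIV"
    "closed_csubspace R" "closed_csubspace K"
  using assms aff_closed[of R] aff_closed[of K] unfolding complementary_def by simp_all

lemma aff_subspace_unitary:
  assumes "aff_subspace M S" "U \<in> commutant M" "is_unitary U"
  shows "U x \<in> S \<longleftrightarrow> x \<in> S"
proof
  obtain V where V: "V \<in> commutant M" "is_unitary V" "\<And>x. V (U x) = x"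
    using unitary_commutant_inverse[OF star_closed assms(2,3)] by metis
  have inv: "\<And>W y. W \<in> commutant M \<Longrightarrow> is_unitary W \<Longrightarrow> y \<in> S \<Longrightarrow> W y \<in> S"
    using assms(1) unfolding aff_subspace_iff by blast
  show "U x \<in> S \<Longrightarrow> x \<in> S" using inv[OF V(1,2)] V(3) by metis
  show "x \<in> S \<Longrightarrow> U x \<in> S" using inv[OF assms(2,3)] .
qed

lemma oblique_affiliated:
  assumes "complementary R K"
  shows "oblique R K \<in> affiliated_ops M"
proof -
  note RK = complementaryD[OF assms]
  have "op_times (graph_of U) (oblique R K) = op_times (oblique R K) (graph_of U)"
    if U: "U \<in> commutant M" "is_unitary U" for U
  proof (intro set_eqI iffI; clarify)
    note inv = aff_subspace_unitary[OF RK(1) U] aff_subspace_unitary[OF RK(2) U]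
    fix x z assume "(x, z) \<in> op_times (graph_of U) (oblique R K)"
    then obtain y where "z = U y" "y \<in> R" "x - y \<in> K"
      by (auto simp: op_times_def graph_of_def in_oblique_iff)
    then have "(U x, z) \<in> oblique R K"
      using inv by (simp add: in_oblique_iff flip: commutant_linear(3)[OF U(1)])
    then show "(x, z) \<in> op_times (oblique R K) (graph_of U)" by (auto simp: op_times_def graph_of_def)
  next
    note inv = aff_subspace_unitary[OF RK(1) U] aff_subspace_unitary[OF RK(2) U]
    obtain V where V: "\<And>x. U (V x) = x"
      using unitary_commutant_inverse[OF star_closed U] by metis
    fix x z assume "(x, z) \<in> op_times (oblique R K) (graph_of U)"
    then have z: "U (V z) \<in> R" "U x - U (V z) \<in> K"
      by (auto simp: op_times_def graph_of_def in_oblique_iff V)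
    then have "V z \<in> R" "x - V z \<in> K"
      using inv by (simp_all flip: commutant_linear(3)[OF U(1)])
    then have "(x, V z) \<in> oblique R K" by (simp add: in_oblique_iff)
    moreover have "(V z, z) \<in> graph_of U" using V[of z] by (auto simp: graph_of_def)
    ultimately show "(x, z) \<in> op_times (graph_of U) (oblique R K)" by (auto simp: op_times_def)
  qed
  then show ?thesis
    by (simp add: affiliated_ops_def linear_operator_oblique closed_oblique closure_Domain_oblique RK)
qed

lemma oblique_idempotent: "complementary R K \<Longrightarrow> aff_idempotent M (oblique R K)"
  by (simp add: aff_idempotent_def oblique_affiliated aff_times_oblique_self complementaryD)

lemma op_uminus_affiliated:
  assumes T: "T \<in> affiliated_ops M"
  shows "op_uminus T \<in> affiliated_ops M"
proof -
  have lin: "linear_operator T" using T by (simp add: affiliated_ops_def)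
  have "linear_operator (op_uminus T)"
    unfolding linear_operator_def single_valued_def in_op_uminus_iff
  proof (intro conjI allI impI)
    show "y = z" if "(x, - y) \<in> T" "(x, - z) \<in> T" for x y z
      using lin that unfolding linear_operator_def single_valued_def by (metis neg_equal_iff_equal)
    show "(0, - 0) \<in> T" using lin by (simp add: linear_operator_def)
    show "(x + x', - (y + y')) \<in> T" if "(x, - y) \<in> T \<and> (x', - y') \<in> T" for x x' y y'
    proof -
      have "(x + x', - y + - y') \<in> T" using lin that unfolding linear_operator_def by blast
      then show ?thesis by (simp add: add.commute)
    qed
    show "(c *\<^sub>C x, - (c *\<^sub>C y)) \<in> T" if "(x, - y) \<in> T" for c x y
    proof -
      have "(c *\<^sub>C x, c *\<^sub>C - y) \<in> T" using lin that unfolding linear_operator_def by blast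
      then show ?thesis by (simp add: scaleC.minus_right)
    qed
  qed
  moreover have "closed (op_uminus T)" using T by (simp add: affiliated_ops_def closed_op_uminus)
  moreover have "Domain (op_uminus T) = Domain T"
    by (auto simp: op_uminus_def)
  moreover have "op_times (graph_of U) (op_uminus T) = op_times (op_uminus T) (graph_of U)"
    if U: "U \<in> commutant M" "is_unitary U" for U
  proof -
    have *: "op_times (graph_of U) T = op_times T (graph_of U)"
      using T U by (simp add: affiliated_ops_def)
    have neg: "U (- y) = - U y" for y
      using bounded_op_linear(6)[of U] U(1) by (simp add: in_commutant_iff)
    have "(x, z) \<in> op_times (graph_of U) (op_uminus T) \<longleftrightarrow> (x, - z) \<in> op_times (graph_of U) T" for x z
      unfolding in_op_times_graph_of_iff in_op_uminus_iff by (metis neg minus_minus)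
    then show ?thesis
      by (intro set_eqI; clarify)
        (simp add: * in_op_times_graph_of_iff(2) in_op_uminus_iff)
  qed
  ultimately show ?thesis using T by (simp add: affiliated_ops_def)
qed

text \<open>On the domain of \<open>e \<circ> e\<close>, a core of \<open>e\<close>, the values of \<open>e\<close> are fixed by \<open>e\<close>; as \<open>e\<close> is closed,
  this extends to its whole range.\<close>

lemma idempotent_obtain_oblique:
  assumes "aff_idempotent M e"
  obtains R K where "complementary R K" "e = oblique R K"
proof -
  have aff: "e \<in> affiliated_ops M" and idem: "closure (op_times e e) = e"
    using assms by (simp_all add: aff_idempotent_def aff_times_def)
  have cl: "closed e" and dense: "closure (Domain e) = UNIV" and lin: "linear_operator e"
    using aff by (simp_all add: affiliated_ops_def)
  have sv: "y = z" if "(x, y) \<in> e" "(x, z) \<in> e" for x y z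
    using lin that by (auto simp: linear_operator_def single_valued_def)
  have add: "(x + x', y + y') \<in> e" if "(x, y) \<in> e" "(x', y') \<in> e" for x y x' y'
    using lin that by (auto simp: linear_operator_def)
  have scale: "(c *\<^sub>C x, c *\<^sub>C y) \<in> e" if "(x, y) \<in> e" for c x y
    using lin that by (auto simp: linear_operator_def)
  have zero: "(0, 0) \<in> e" using lin by (simp add: linear_operator_def)
  have diff: "(x - x', y - y') \<in> e" if "(x, y) \<in> e" "(x', y') \<in> e" for x y x' y'
    using add[OF that(1) scale[OF that(2), of "-1"]] by (simp add: scaleC.minus_left)
  have "closed {p. (snd p, snd p) \<in> e}"
    using closed_vimage[OF cl, of "\<lambda>p. (snd p, snd p)"] by (simp add: vimage_def continuous_intros)
  moreover have "op_times e e \<subseteq> {p. (snd p, snd p) \<in> e}"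
  proof clarify
    fix x z assume xz: "(x, z) \<in> op_times e e"
    then obtain y where y: "(x, y) \<in> e" "(y, z) \<in> e" by (auto simp: op_times_def)
    \<comment> \<open>The product is contained in its closure, which is \<open>e\<close>, so
      single-valuedness identifies the intermediate value \<open>y\<close> with
      \<open>z\<close>.\<close>
    moreover have "(x, z) \<in> e" using xz idem closure_subset by blast
    ultimately show "(snd (x, z), snd (x, z)) \<in> e" using sv by auto
  qed
  ultimately have "e \<subseteq> {p. (snd p, snd p) \<in> e}" using closure_minimal idem by blast
  then have fixed: "(y, y) \<in> e" if "(x, y) \<in> e" for x y using that by force
  define R where "R = {y. (y, y) \<in> e}"
  define K where "K = {x. (x, 0) \<in> e}"
  have "closed R"
    using closed_vimage[OF cl, of "\<lambda>y. (y, y)"] by (simp add: R_def vimage_def continuous_intros)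
  moreover have "complex_vector.subspace R"
    using zero add scale unfolding complex_vector.subspace_def R_def by blast
  ultimately have R: "closed_csubspace R" by (simp add: closed_csubspace_def)
  have "closed K"
    using closed_vimage[OF cl, of "\<lambda>x. (x, 0)"] by (simp add: K_def vimage_def continuous_intros)
  moreover have "complex_vector.subspace K"
    using zero add[where y=0 and y'=0] scale[where y=0]
    by (auto simp: complex_vector.subspace_def K_def)
  ultimately have K: "closed_csubspace K" by (simp add: closed_csubspace_def)
  have e: "e = oblique R K"
  proof (intro set_eqI iffI; clarify)
    fix x y assume xy: "(x, y) \<in> e"
    then have "(y, y) \<in> e" by (rule fixed)
    with diff[OF xy this] show "(x, y) \<in> oblique R K" by (simp add: in_oblique_iff R_def K_def)
  next
    fix x y assume "(x, y) \<in> oblique R K"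
    then have "(y, y) \<in> e" "(x - y, 0) \<in> e" by (simp_all add: in_oblique_iff R_def K_def)
    from add[OF this] show "(x, y) \<in> e" by simp
  qed
  have inv: "(U x, U y) \<in> e" if "U \<in> commutant M" "is_unitary U" "(x, y) \<in> e" for U x y
  proof -
    have "(x, U y) \<in> op_times (graph_of U) e"
      using that(3) by (auto simp: op_times_def graph_of_def)
    also have "op_times (graph_of U) e = op_times e (graph_of U)"
      using aff that by (simp add: affiliated_ops_def)
    finally show ?thesis by (auto simp: op_times_def graph_of_def)
  qed
  have "aff_subspace M R" unfolding aff_subspace_iff using R inv by (auto simp: R_def)
  moreover have "aff_subspace M K"
    unfolding aff_subspace_iff using K inv commutant_linear(4) unfolding K_def by fastforce
  moreover have "R \<inter> K = {0}" using sv zero by (auto simp: R_def K_def)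
  moreover have "closed_cspan (R \<union> K) = UNIV" using dense closure_Domain_oblique[OF R K] e by simp
  ultimately show thesis using that[of R K] e by (simp add: complementary_def)
qed

end

section \<open>Sums of orthogonal idempotents\<close>

context tracial_vna
begin

lemma dim_tau_join_disjoint:
  assumes "aff_subspace M R" "aff_subspace M K" "R \<inter> K = {0}"
  shows "dim_tau (closed_cspan (R \<union> K)) = dim_tau R + dim_tau K"
  using dim_tau_modular[OF assms(1,2)] by (simp add: assms(3) dim_tau_zero)

lemma dim_tau_complementary: "complementary R K \<Longrightarrow> dim_tau R + dim_tau K = 1"
  using dim_tau_join_disjoint[of R K] complementaryD[of R K] dim_tau_UNIV by simp

text \<open>By the modular law a spanning pair has total dimension 1 plus that of its intersection,
  so the bound forces a null, hence zero, intersection. It spares a direct proof of trivial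
  intersection, which is the harder half for closures.\<close>

lemma complementaryI_span:
  assumes R: "aff_subspace M R" and K: "aff_subspace M K"
    and "closed_cspan (R \<union> K) = UNIV" "dim_tau R + dim_tau K \<le> 1"
  shows "complementary R K"
proof -
  have "dim_tau (R \<inter> K) \<le> 0"
    using dim_tau_modular[OF R K] assms(3,4) by (simp add: dim_tau_UNIV)
  then have "{0} = R \<inter> K"
    using closed_csubspaceD(2)[OF aff_closed[OF aff_Int[OF R K]]]
    by (intro dim_tau_eq_imp_eq aff_subspace_zero aff_Int R K) (simp_all add: dim_tau_zero)
  then show ?thesis using assms by (simp add: complementary_def)
qed

text \<open>If \<open>e\<^sub>1 e\<^sub>2 = 0\<close>, then \<open>e\<^sub>2\<close> maps the domain of \<open>e\<^sub>1 \<circ> e\<^sub>2\<close> into \<open>R\<^sub>2 \<inter> K\<^sub>1\<close>; density of this domain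
  gives the intersection full dimension in \<open>R\<^sub>2\<close>.\<close>

lemma range_subset_kernel:
  assumes 1: "complementary R1 K1" and 2: "complementary R2 K2"
    and prod: "aff_times (oblique R1 K1) (oblique R2 K2) = aff_zero"
  shows "R2 \<subseteq> K1"
proof -
  note D1 = complementaryD[OF 1] and D2 = complementaryD[OF 2]
  let ?T = "op_times (oblique R1 K1) (oblique R2 K2)" and ?S = "R2 \<inter> K1"
  let ?J = "closed_cspan (?S \<union> K2)"
  have S: "aff_subspace M ?S" by (rule aff_Int[OF D2(1) D1(2)])
  have "?T \<subseteq> fst -` ?J"
  proof clarify
    fix x z assume xz: "(x, z) \<in> ?T"
    then have "(x, z) \<in> aff_zero"
      using prod closure_subset unfolding aff_times_def by blast
    then have "z = 0" by (simp add: in_aff_zero_iff)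
    then obtain y where y: "y \<in> R2" "x - y \<in> K2" "y \<in> K1"
      using xz by (auto simp: op_times_def in_oblique_iff)
    then have "y \<in> ?J" "x - y \<in> ?J" using closed_cspan_superset[of "?S \<union> K2"] by auto
    then have "y + (x - y) \<in> ?J" by (rule closed_csubspaceD(3)[OF closed_csubspace_closed_cspan])
    then show "(x, z) \<in> fst -` ?J" by simp
  qed
  moreover have "closed (fst -` ?J)"
    by (intro closed_vimage closed_csubspaceD(1) closed_csubspace_closed_cspan continuous_intros)
  \<comment> \<open>The closure of the product is defined everywhere, so the closed condition on its
    domain forces \<open>?J\<close> to be the whole space.\<close>
  ultimately have "aff_zero \<subseteq> fst -` ?J"
    unfolding prod[symmetric] aff_times_def by (rule closure_minimal)
  then have J: "?J = UNIV" by (auto simp: subset_iff in_aff_zero_iff)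
  have "?S \<inter> K2 = {0}" using D2(3) D1(6) closed_csubspaceD(2) by blast
  then have "dim_tau ?S + dim_tau K2 = 1"
    using dim_tau_join_disjoint[OF S D2(2)] J by (simp add: dim_tau_UNIV)
  then have "?S = R2"
    using dim_tau_complementary[OF 2] by (intro dim_tau_eq_imp_eq S D2(1)) auto
  then show ?thesis by blast
qed

text \<open>Everything rests on a lower bound for the dimension of \<open>K1 \<inter> K2\<close>:
  the join of the kernels has dimension at most 1, so the modular law bounds their intersection from
  below. With it \<open>R2\<close> and \<open>K1 \<inter> K2\<close> have enough dimension to fill
  \<open>K1\<close>, and spanning and the remaining equality follow by further counts. The last two
  conclusions feed \<open>aff_minus_oblique\<close>.\<close>

lemma complementary_sum:
  assumes 1: "complementary R1 K1" and 2: "complementary R2 K2" and sub: "R1 \<subseteq> K2" "R2 \<subseteq> K1"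
  shows "complementary (closed_cspan (R1 \<union> R2)) (K1 \<inter> K2)"
    and "closed_cspan (R2 \<union> (K1 \<inter> K2)) = K1"
    and "closed_cspan (R1 \<union> R2) \<inter> K1 = R2"
proof -
  note D1 = complementaryD[OF 1] and D2 = complementaryD[OF 2]
  note d = dim_tau_complementary[OF 1] dim_tau_complementary[OF 2]
  let ?R = "closed_cspan (R1 \<union> R2)" and ?K = "K1 \<inter> K2"
  have R: "aff_subspace M ?R" by (rule aff_closed_cspan_Un[OF D1(1) D2(1)])
  have K: "aff_subspace M ?K" by (rule aff_Int[OF D1(2) D2(2)])
  have zero: "0 \<in> R1" "0 \<in> R2" "0 \<in> K1" "0 \<in> K2" using D1 D2 closed_csubspaceD(2) by blast+
  have "dim_tau (closed_cspan (K1 \<union> K2)) \<le> 1"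
    using dim_tau_mono[OF aff_closed_cspan_Un[OF D1(2) D2(2)] aff_subspace_UNIV] by (simp add: dim_tau_UNIV)
  then have dK: "dim_tau K1 + dim_tau K2 - 1 \<le> dim_tau ?K"
    using dim_tau_modular[OF D1(2) D2(2)] by simp
  have "R2 \<inter> ?K = {0}" using D2(3) zero by blast
  then have dJ: "dim_tau (closed_cspan (R2 \<union> ?K)) = dim_tau R2 + dim_tau ?K"
    by (rule dim_tau_join_disjoint[OF D2(1) K])
  show K1: "closed_cspan (R2 \<union> ?K) = K1"
  proof (rule dim_tau_eq_imp_eq[OF aff_closed_cspan_Un[OF D2(1) K] D1(2)])
    show "closed_cspan (R2 \<union> ?K) \<subseteq> K1" using sub D1(6) by (intro closed_cspan_minimal) auto
    show "dim_tau K1 \<le> dim_tau (closed_cspan (R2 \<union> ?K))" using dJ dK d by simp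
  qed
  have "R1 \<inter> R2 = {0}" using D1(3) sub zero by blast
  then have dR: "dim_tau ?R = dim_tau R1 + dim_tau R2" by (rule dim_tau_join_disjoint[OF D1(1) D2(1)])
  have RJ: "R1 \<subseteq> ?R" "R2 \<subseteq> ?R" using closed_cspan_superset[of "R1 \<union> R2"] by blast+
  let ?J = "closed_cspan (?R \<union> ?K)"
  have J: "?R \<subseteq> ?J" "?K \<subseteq> ?J" using closed_cspan_superset[of "?R \<union> ?K"] by blast+
  have "closed_cspan (R2 \<union> ?K) \<subseteq> ?J" using RJ J by (intro closed_cspan_minimal) auto
  then have "closed_cspan (R1 \<union> K1) \<subseteq> ?J" using RJ J K1 by (intro closed_cspan_minimal) auto
  then have "?J = UNIV" using D1(4) by auto
  moreover have "dim_tau ?R + dim_tau ?K \<le> 1" using dJ d dR K1 by simp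
  ultimately show "complementary ?R ?K" by (intro complementaryI_span R K)
  have "closed_cspan (?R \<union> K1) = UNIV"
    using closed_cspan_mono[of "R1 \<union> K1" "?R \<union> K1"] RJ D1(4) by auto
  then have "dim_tau (?R \<inter> K1) = dim_tau R2"
    using dim_tau_modular[OF R D1(2)] dR d by (simp add: dim_tau_UNIV)
  then have "R2 = ?R \<inter> K1"
    using sub RJ by (intro dim_tau_eq_imp_eq D2(1) aff_Int R D1(2)) auto
  then show "?R \<inter> K1 = R2" by simp
qed

end

text \<open>A locale, because the convergence proof instantiates the whole construction again for
  shifted sequences.\<close>

locale orthogonal_complementary = tracial_vna M \<tau> for M :: "('a::complex_hilbert \<Rightarrow> 'a) set" and \<tau> +
  fixes R K :: "nat \<Rightarrow> 'a set"
  assumes comp: "\<And>n. complementary (R n) (K n)" and orth: "\<And>m n. m \<noteq> n \<Longrightarrow> R m \<subseteq> K n"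
begin

section \<open>Partial sums and the infinite sum\<close>

definition range_upto :: "nat \<Rightarrow> 'a set" where
  "range_upto N = closed_cspan (\<Union>n<N. R n)"

definition kernel_upto :: "nat \<Rightarrow> 'a set" where
  "kernel_upto N = (\<Inter>n<N. K n)"

definition range_sum :: "'a set" where
  "range_sum = closed_cspan (\<Union>n. R n)"

definition kernel_sum :: "'a set" where
  "kernel_sum = (\<Inter>n. K n)"

lemma closed_kernel: "closed_csubspace (K n)"
  and closed_range: "closed_csubspace (R n)"
  using complementaryD[OF comp] by blast+

lemma range_upto_0: "range_upto 0 = {0}"
  using closed_cspan_id[OF closed_csubspace_zero]
  by (simp add: range_upto_def closed_cspan_def)

lemma kernel_upto_0: "kernel_upto 0 = UNIV"
  by (simp add: kernel_upto_def)

lemma range_upto_Suc: "range_upto (Suc N) = closed_cspan (range_upto N \<union> R N)"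
proof
  show "range_upto (Suc N) \<subseteq> closed_cspan (range_upto N \<union> R N)"
    unfolding range_upto_def lessThan_Suc
    by (intro closed_cspan_minimal) (use closed_cspan_superset[of "(\<Union>n<N. R n)"]
      closed_cspan_superset[of "closed_cspan (\<Union>n<N. R n) \<union> R N"] in auto)
  show "closed_cspan (range_upto N \<union> R N) \<subseteq> range_upto (Suc N)"
    unfolding range_upto_def lessThan_Suc
    by (intro closed_cspan_minimal Un_least closed_cspan_mono)
      (use closed_cspan_superset[of "(\<Union>n\<in>insert N {..<N}. R n)"] in auto)
qed

lemma kernel_upto_Suc: "kernel_upto (Suc N) = kernel_upto N \<inter> K N"
  by (auto simp: kernel_upto_def lessThan_Suc)

lemma range_upto_subset: "N \<le> n \<Longrightarrow> range_upto N \<subseteq> K n"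
  unfolding range_upto_def using orth closed_kernel by (intro closed_cspan_minimal UN_least) auto

lemma range_subset_kernel_upto: "N \<le> n \<Longrightarrow> R n \<subseteq> kernel_upto N"
  unfolding kernel_upto_def using orth by (intro INT_greatest) auto

lemma complementary_upto: "complementary (range_upto N) (kernel_upto N)"
proof (induction N)
  case 0
  show ?case
    by (simp add: range_upto_0 kernel_upto_0 complementary_def aff_subspace_UNIV aff_subspace_zero closed_cspan_id)
next
  case (Suc N)
  show ?case unfolding range_upto_Suc kernel_upto_Suc
    by (rule complementary_sum(1)[OF Suc comp range_upto_subset range_subset_kernel_upto]) simp_all
qed

lemma aff_upto: "aff_subspace M (range_upto N)" "aff_subspace M (kernel_upto N)"
  using complementaryD[OF complementary_upto] by blast+

lemma dim_range_upto: "dim_tau (range_upto N) = (\<Sum>n<N. dim_tau (R n))"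
proof (induction N)
  case 0
  show ?case by (simp add: range_upto_0 dim_tau_zero)
next
  case (Suc N)
  have "range_upto N \<inter> R N = {0}"
    using range_upto_subset[of N N] complementaryD[OF comp[of N]] complementaryD(5)[OF complementary_upto[of N]]
    by (intro Int_eq_zero_subset) auto
  then show ?case
    using dim_tau_join_disjoint[OF aff_upto(1) complementaryD(1)[OF comp]] Suc
    by (simp add: range_upto_Suc)
qed

lemma range_upto_subset_sum: "range_upto N \<subseteq> range_sum"
  unfolding range_upto_def range_sum_def by (intro closed_cspan_mono UN_mono) simp_all

lemma kernel_sum_subset_upto: "kernel_sum \<subseteq> kernel_upto N"
  unfolding kernel_upto_def kernel_sum_def by (intro INT_anti_mono) simp_all

lemma incseq_range_upto: "incseq range_upto"
  unfolding incseq_def range_upto_def by (intro allI impI closed_cspan_mono UN_mono) simp_all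

lemma decseq_kernel_upto: "decseq kernel_upto"
  unfolding decseq_def kernel_upto_def by (intro allI impI INT_anti_mono) simp_all

lemma closed_cspan_range_upto: "closed_cspan (\<Union>N. range_upto N) = range_sum"
proof
  show "closed_cspan (\<Union>N. range_upto N) \<subseteq> range_sum"
    using range_upto_subset_sum by (intro closed_cspan_minimal) (auto simp: range_sum_def)
  have "R n \<subseteq> range_upto (Suc n)" for n
    unfolding range_upto_def using closed_cspan_superset[of "\<Union>n<Suc n. R n"] by auto
  then show "range_sum \<subseteq> closed_cspan (\<Union>N. range_upto N)"
    unfolding range_sum_def by (intro closed_cspan_mono) blast
qed

lemma INT_kernel_upto: "(\<Inter>N. kernel_upto N) = kernel_sum"
  by (auto simp: kernel_upto_def kernel_sum_def)

lemma aff_subspace_sum: "aff_subspace M range_sum" "aff_subspace M kernel_sum"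
  unfolding range_sum_def kernel_sum_def
  by (intro aff_closed_cspan_UN aff_INT complementaryD[OF comp])+

lemma dim_range_upto_tendsto: "(\<lambda>N. dim_tau (range_upto N)) \<longlonglongrightarrow> dim_tau range_sum"
  using dim_tau_increasing_tendsto[OF aff_upto(1) incseq_range_upto] by (simp add: closed_cspan_range_upto)

text \<open>Normality, used upwards for the ranges and downwards for the kernels, makes the limiting
  dimensions add up to 1. Spanning is obtained through finite stages: \<open>kernel_sum\<close> lies
  in \<open>kernel_upto N\<close>, so it is disjoint from \<open>range_upto N\<close> and their join
  has the sum of the dimensions; letting \<open>N\<close> grow, the full join reaches dimension 1.
  The count then excludes a nonzero intersection.\<close>

lemma complementary_infinite: "complementary range_sum kernel_sum"
proof -
  have "(\<lambda>N. dim_tau (kernel_upto N)) \<longlonglongrightarrow> dim_tau kernel_sum"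
    using dim_tau_decreasing_tendsto[OF aff_upto(2) decseq_kernel_upto] by (simp add: INT_kernel_upto)
  from tendsto_add[OF dim_range_upto_tendsto this]
  have "dim_tau range_sum + dim_tau kernel_sum = 1"
    by (simp add: dim_tau_complementary[OF complementary_upto] LIMSEQ_const_iff)
  moreover
  let ?J = "closed_cspan (range_sum \<union> kernel_sum)"
  have J: "aff_subspace M ?J" by (intro aff_closed_cspan_Un aff_subspace_sum)
  have "dim_tau (range_upto N) + dim_tau kernel_sum \<le> dim_tau ?J" for N
  proof -
    have "range_upto N \<inter> kernel_sum = {0}"
      using complementaryD(3,5)[OF complementary_upto[of N]] kernel_sum_subset_upto[of N] aff_closed[OF aff_subspace_sum(2)]
      by (intro Int_eq_zero_subset) auto
    then have "dim_tau (range_upto N) + dim_tau kernel_sum = dim_tau (closed_cspan (range_upto N \<union> kernel_sum))"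
      using dim_tau_join_disjoint[OF aff_upto(1) aff_subspace_sum(2)] by simp
    also have "\<dots> \<le> dim_tau ?J"
      using range_upto_subset_sum[of N]
      by (intro dim_tau_mono aff_closed_cspan_Un aff_upto aff_subspace_sum closed_cspan_mono) auto
    finally show ?thesis .
  qed
  then have "dim_tau range_sum + dim_tau kernel_sum \<le> dim_tau ?J"
    by (intro LIMSEQ_le_const2[OF tendsto_add[OF dim_range_upto_tendsto tendsto_const]]) auto
  ultimately have "?J = UNIV"
    by (intro dim_tau_eq_imp_eq J aff_subspace_UNIV) (simp_all add: dim_tau_UNIV)
  with \<open>dim_tau range_sum + dim_tau kernel_sum = 1\<close> show ?thesis
    by (intro complementaryI_span aff_subspace_sum) simp_all
qed

lemma aff_sum_oblique: "aff_sum (\<lambda>n. oblique (R n) (K n)) N = oblique (range_upto N) (kernel_upto N)"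
proof (induction N)
  case 0
  show ?case by (simp add: range_upto_0 kernel_upto_0 oblique_zero_UNIV)
next
  case (Suc N)
  then show ?case
    using aff_plus_oblique[OF complementaryD(5,6)[OF complementary_upto[of N]] closed_range closed_kernel]
    by (simp add: range_upto_Suc kernel_upto_Suc range_upto_subset range_subset_kernel_upto)
qed

section \<open>Support, trace and convergence of the sum\<close>

lemma increases_to_supp:
  "increases_to (\<lambda>N. supp (oblique (range_upto N) (kernel_upto N))) (supp (oblique range_sum kernel_sum))"
proof -
  have "incseq (\<lambda>N. orth_compl (kernel_upto N))"
    using decseq_kernel_upto unfolding incseq_def decseq_def by (intro allI impI orth_compl_antimono) simp
  moreover have "closed_cspan (\<Union>N. orth_compl (kernel_upto N)) = orth_compl kernel_sum"
    using aff_closed[OF aff_upto(2)] by (simp add: orth_compl_INT flip: INT_kernel_upto)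
  ultimately show ?thesis
    using proj_increasing_tendsto[of "\<lambda>N. orth_compl (kernel_upto N)"]
    by (simp add: increases_to_def supp_oblique aff_closed aff_upto aff_subspace_sum op_le_proj_iff incseq_Suc_iff)
qed

lemma supp_projection_Sup:
  "is_projection_Sup (range (\<lambda>n. supp (oblique (R n) (K n)))) (supp (oblique range_sum kernel_sum))"
proof -
  have "orth_compl kernel_sum \<subseteq> range P"
    if P: "is_projection P" and "\<And>n. op_le (proj (orth_compl (K n))) P" for P
  proof -
    have "orth_compl (K n) \<subseteq> range P" for n
      using that(2)[of n] op_le_proj_iff[OF _ closed_csubspace_range_projection[OF P]]
      by (simp add: proj_range[OF P])
    then have "closed_cspan (\<Union>n. orth_compl (K n)) \<subseteq> range P"
      by (intro closed_cspan_minimal closed_csubspace_range_projection[OF P]) auto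
    then show ?thesis using closed_kernel by (simp add: kernel_sum_def orth_compl_INT)
  qed
  then have "op_le (proj (orth_compl kernel_sum)) P"
    if "is_projection P" "\<And>n. op_le (proj (orth_compl (K n))) P" for P
    using that op_le_proj_iff[OF _ closed_csubspace_range_projection[OF that(1)], of "orth_compl kernel_sum"]
    by (simp add: proj_range)
  moreover have "orth_compl (K n) \<subseteq> orth_compl kernel_sum" for n
    unfolding kernel_sum_def by (intro orth_compl_antimono) auto
  ultimately show ?thesis
    by (simp add: is_projection_Sup_def supp_oblique closed_range aff_closed aff_subspace_sum is_projection_proj op_le_proj_iff)
qed

text \<open>The trace is defined through the support, the complement of the kernel; complementarity
  gives range and support the same dimension. Additivity of the trace thus becomes additivity of the
  dimensions of the ranges.\<close>

lemma tr_oblique: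
  assumes "complementary S L"
  shows "tr \<tau> (oblique S L) = complex_of_real (dim_tau S)"
proof -
  have "dim_tau (orth_compl L) = dim_tau S"
    using dim_tau_complementary[OF assms] complementaryD(2)[OF assms] by (simp add: dim_tau_orth_compl)
  then show ?thesis
    using complementaryD[OF assms] by (simp add: tr_def supp_oblique tau_proj aff_orth_compl)
qed

lemma tr_sums: "(\<lambda>n. tr \<tau> (oblique (R n) (K n))) sums tr \<tau> (oblique range_sum kernel_sum)"
  using dim_range_upto_tendsto
  by (simp add: tr_oblique comp complementary_infinite sums_of_real_iff)
    (simp add: sums_def dim_range_upto)

text \<open>The difference \<open>E\<^sub>N - E\<close> is the negative of the idempotent \<open>\<Sum>\<^sub>n\<^sub>\<ge>\<^sub>N e\<^sub>n\<close>, which vanishes on its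
  kernel, and the codimension of this kernel tends to zero.\<close>

lemma converges_in_measure_sum:
  "converges_in_measure M \<tau> (\<lambda>N. oblique (range_upto N) (kernel_upto N)) (oblique range_sum kernel_sum)"
  unfolding converges_in_measure_def
proof (intro conjI allI impI)
  fix \<epsilon> \<delta> :: real assume "0 < \<epsilon>" "0 < \<delta>"
  have "(\<lambda>N. dim_tau range_sum - dim_tau (range_upto N)) \<longlonglongrightarrow> dim_tau range_sum - dim_tau range_sum"
    by (intro tendsto_diff tendsto_const dim_range_upto_tendsto)
  then have "\<forall>\<^sub>F N in sequentially. dim_tau range_sum - dim_tau (range_upto N) < \<delta>"
    using \<open>0 < \<delta>\<close> by (simp add: order_tendstoD(2))
  then show "\<forall>\<^sub>F N in sequentially. aff_minus (oblique (range_upto N) (kernel_upto N))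
      (oblique range_sum kernel_sum) \<in> measure_nhd M \<tau> \<epsilon> \<delta>"
  proof eventually_elim
    case (elim N)
    \<comment> \<open>The idempotents from index \<open>N\<close> on form a sequence of the same
      kind, so the results already proved produce their infinite sum.\<close>
    interpret tail: orthogonal_complementary M \<tau> "\<lambda>n. R (n + N)" "\<lambda>n. K (n + N)"
      by unfold_locales (simp_all add: comp orth)
    let ?R = tail.range_sum and ?K = tail.kernel_sum
    note upto = complementary_upto[of N] and tail = tail.complementary_infinite
    have sub: "range_upto N \<subseteq> ?K" "?R \<subseteq> kernel_upto N"
    proof -
      show "range_upto N \<subseteq> ?K"
        unfolding tail.kernel_sum_def using range_upto_subset by (intro INT_greatest) simp
      show "?R \<subseteq> kernel_upto N"
        unfolding tail.range_sum_def using range_subset_kernel_upto complementaryD(6)[OF upto]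
        by (intro closed_cspan_minimal UN_least) simp_all
    qed
    have index: "n < N \<or> (\<exists>m. n = m + N)" for n
      by (metis add.commute le_Suc_ex not_le)
    have R: "range_sum = closed_cspan (range_upto N \<union> ?R)"
    proof
      have "R n \<subseteq> range_upto N \<union> ?R" for n
        using index[of n] closed_cspan_superset[of "\<Union>n<N. R n"] closed_cspan_superset[of "\<Union>n. R (n + N)"]
        unfolding range_upto_def tail.range_sum_def by blast
      then show "range_sum \<subseteq> closed_cspan (range_upto N \<union> ?R)"
        unfolding range_sum_def by (intro closed_cspan_mono) blast
      have "?R \<subseteq> range_sum"
        unfolding range_sum_def tail.range_sum_def by (intro closed_cspan_mono) blast
      then show "closed_cspan (range_upto N \<union> ?R) \<subseteq> range_sum"
        using range_upto_subset_sum aff_closed[OF aff_subspace_sum(1)] by (intro closed_cspan_minimal) auto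
    qed
    have K: "kernel_sum = kernel_upto N \<inter> ?K"
    proof
      show "kernel_sum \<subseteq> kernel_upto N \<inter> ?K"
        using kernel_sum_subset_upto unfolding kernel_sum_def tail.kernel_sum_def by auto
      have "kernel_upto N \<inter> ?K \<subseteq> K n" for n
        using index[of n] unfolding kernel_upto_def tail.kernel_sum_def by auto
      then show "kernel_upto N \<inter> ?K \<subseteq> kernel_sum" unfolding kernel_sum_def by blast
    qed
    \<comment> \<open>This and the next fact are the hypotheses \<open>eq\<close> of
      \<open>aff_minus_oblique\<close>, obtained by viewing the whole sum as head plus tail.\<close>
    have R_Int: "range_sum \<inter> kernel_upto N = ?R"
      unfolding R by (rule complementary_sum(3)[OF upto tail sub])
    have K_join: "closed_cspan (range_upto N \<union> kernel_sum) = ?K"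
      using complementary_sum(2)[OF tail upto sub(2,1)] by (simp add: K Int_commute)
    let ?T = "op_uminus (oblique ?R ?K)"
    have minus: "aff_minus (oblique (range_upto N) (kernel_upto N)) (oblique range_sum kernel_sum) = ?T"
    proof (rule aff_minus_oblique)
      show "range_upto N \<subseteq> range_sum" by (rule range_upto_subset_sum)
    qed (use complementaryD[OF upto] complementaryD[OF tail] aff_closed[OF aff_subspace_sum(1)]
        aff_closed[OF aff_subspace_sum(2)] sub R_Int K_join K in auto)
    have PM: "proj ?K \<in> M" and P: "is_projection (proj ?K)"
      using aff_proj_in is_projection_proj complementaryD(2,6)[OF tail] by blast+
    have "(x, z) \<in> op_times ?T (graph_of (proj ?K)) \<longleftrightarrow> (x, z) \<in> aff_zero" for x z
    proof -
      have p: "proj ?K x \<in> ?K" by (rule proj_basic(6)[OF complementaryD(6)[OF tail]])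
      have "- z \<in> ?R \<and> proj ?K x + z \<in> ?K \<longleftrightarrow> z = 0"
      proof
        assume *: "- z \<in> ?R \<and> proj ?K x + z \<in> ?K"
        have "proj ?K x - (proj ?K x + z) \<in> ?K"
          using closed_csubspaceD(5)[OF complementaryD(6)[OF tail] p] * by blast
        then have "- z \<in> ?R \<inter> ?K" using * by simp
        then show "z = 0" unfolding complementaryD(3)[OF tail] by simp
      qed (use p closed_csubspaceD(2)[OF complementaryD(5)[OF tail]] in simp)
      then show ?thesis
        by (simp add: in_op_times_graph_of_iff in_op_uminus_iff in_oblique_iff in_aff_zero_iff)
    qed
    then have "op_times ?T (graph_of (proj ?K)) = aff_zero"
      unfolding set_eq_iff split_paired_All by blast
    moreover have "closed (aff_zero :: 'a unbounded_op)"
      using closed_oblique[of "{0}" UNIV] by (simp add: oblique_zero_UNIV)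
    ultimately have times: "aff_times ?T (graph_of (proj ?K)) = aff_zero"
      by (simp add: aff_times_def)
    have "op_norm_le (aff_times ?T (graph_of (proj ?K))) \<epsilon>"
      unfolding times op_norm_le_def using \<open>0 < \<epsilon>\<close> by (auto simp: in_aff_zero_iff Domain_iff)
    \<comment> \<open>The complement of the kernel of the tail has the dimension of the range of the
      tail, which by disjointness is what the head leaves of
      \<open>dim_tau range_sum\<close>.\<close>
    moreover have "Re (\<tau> (\<lambda>x. x - proj ?K x)) \<le> \<delta>"
    proof -
      have "range_upto N \<inter> ?R = {0}"
        using sub complementaryD[OF upto] complementaryD(5)[OF tail] by (intro Int_eq_zero_subset) auto
      then have "dim_tau range_sum = dim_tau (range_upto N) + dim_tau ?R"
        unfolding R by (rule dim_tau_join_disjoint[OF aff_upto(1) tail.aff_subspace_sum(1)])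
      then show ?thesis
        using elim dim_tau_complementary[OF tail]
        by (simp add: tau_diff[OF id_in(2) PM] tau_id flip: dim_tau_def)
    qed
    ultimately show ?case
      unfolding minus measure_nhd_def
      using PM P op_uminus_affiliated[OF oblique_affiliated[OF tail]] by blast
  qed
qed (intro oblique_affiliated complementary_infinite complementary_upto)+

end

theorem proposition2p8:
  fixes M :: "('a::complex_hilbert \<Rightarrow> 'a) set"
    and \<tau> :: "('a \<Rightarrow> 'a) \<Rightarrow> complex"
    and e :: "nat \<Rightarrow> 'a unbounded_op"
  assumes "finite_von_neumann_algebra M"
    and "state_on M \<tau>" and "tracial_on M \<tau>" and "faithful_on M \<tau>" and "normal_on M \<tau>"
    and "\<And>n. aff_idempotent M (e n)"
    and "\<And>n m. n \<noteq> m \<Longrightarrow> aff_times (e n) (e m) = aff_zero \<and> aff_times (e m) (e n) = aff_zero"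
  shows "\<exists>E. aff_idempotent M E \<and>
           converges_in_measure M \<tau> (aff_sum e) E \<and>
           increases_to (\<lambda>N. supp (aff_sum e N)) (supp E) \<and>
           is_projection_Sup (range (\<lambda>n. supp (e n))) (supp E) \<and>
           (\<lambda>n. tr \<tau> (e n)) sums tr \<tau> E \<and>
           Range E = closed_cspan (\<Union>n. Range (e n))"
proof -
  interpret tracial_vna M \<tau>
    using assms by unfold_locales (auto simp: finite_von_neumann_algebra_def)
  have "\<exists>R K. complementary R K \<and> e n = oblique R K" for n
    using idempotent_obtain_oblique[OF assms(6)] by metis
  then obtain R K where comp: "\<And>n. complementary (R n) (K n)" and e: "\<And>n. e n = oblique (R n) (K n)"
    by metis
  \<comment> \<open>It is the product with \<open>e n\<close> on the left that sends the range of
    \<open>e m\<close> into the kernel of \<open>e n\<close>.\<close>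
  have "R m \<subseteq> K n" if "m \<noteq> n" for m n
    using range_subset_kernel[OF comp comp, of n m] assms(7)[OF that] by (simp add: e)
  then interpret orthogonal_complementary M \<tau> R K
    by unfold_locales (auto intro: comp)
  have e_eq: "e = (\<lambda>n. oblique (R n) (K n))" using e by blast
  show ?thesis
  proof (intro exI conjI)
    show "aff_idempotent M (oblique range_sum kernel_sum)"
      by (rule oblique_idempotent[OF complementary_infinite])
    show "converges_in_measure M \<tau> (aff_sum e) (oblique range_sum kernel_sum)"
      using converges_in_measure_sum unfolding e_eq aff_sum_oblique[abs_def] .
    show "increases_to (\<lambda>N. supp (aff_sum e N)) (supp (oblique range_sum kernel_sum))"
      using increases_to_supp unfolding e_eq aff_sum_oblique .
    show "is_projection_Sup (range (\<lambda>n. supp (e n))) (supp (oblique range_sum kernel_sum))"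
      using supp_projection_Sup unfolding e_eq .
    show "(\<lambda>n. tr \<tau> (e n)) sums tr \<tau> (oblique range_sum kernel_sum)"
      using tr_sums unfolding e_eq .
    show "Range (oblique range_sum kernel_sum) = closed_cspan (\<Union>n. Range (e n))"
      using closed_kernel aff_closed[OF aff_subspace_sum(2)] by (simp add: e Range_oblique range_sum_def)
  qed
qed

end
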